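(* Let $X$ be a metric space that is uniformly locally path connected and uniformly semi-locally simply connected, and let $x_0\in X$. Then the discretisation homomorphism $\pi_1(X,x_0)\to\varprojlim_{\theta}\pi_{1,\theta}(X,x_0)$ is an isomorphism.
   Context: $X$ is a metric space with metric $d$; $B(x,r)$ and $\overline B(x,r)$ denote the open and closed balls of radius $r$ centred at $x$. Local conditions. $X$ is uniformly locally path connected if for every $\epsilon>0$ there exists $\delta>0$ such that for every $x\in X$ any two points in $B(x,\delta)$ are connected by a path with image completely contained in $B(x,\epsilon)$. $X$ is uniformly semi-locally simply connected if there exists $\epsilon>0$ such that for every $x\in X$ every loop with image contained in $B(x,\epsilon)$ is null-homotopic in $X$ (not necessarily in the ball). Discrete fundamental group. Fix $\theta>0$. For $n\in\mathbb{N}$ let $[n]=\{0,1,\dots,n\}$, seen as a subset of $\mathbb{R}$. A $\theta$-path is a $\theta$-Lipschitz map $Z\colon[n]\to X$, equivalently a finite sequence $(z_0,\dots,z_n)$ of points of $X$ with $d(z_i,z_{i+1})\leq\theta$ for all $i$. It is closed if $z_0=z_n$. A $\theta$-path $Z'\colon[m]\to X$ is a lazy version (lazification) of $Z\colon[n]\to X$ if $m>n$ and $Z'=Z\circ f$ for some surjective monotone map $f\colon[m]\to[n]$. For two $\theta$-paths $Z_1,Z_2$ of the same length $n$ with the same endpoints, a $\theta$-grid homotopy between them is a $\theta$-Lipschitz map $H\colon[n]\times[m]\to X$ (with the $\ell^1$ metric on $[n]\times[m]$) such that $H(\cdot,0)=Z_1$, $H(\cdot,m)=Z_2$, and $H(0,t)=Z_1(0)=Z_2(0)$,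 $H(n,t)=Z_1(n)=Z_2(n)$ for every $t\in[m]$. Two $\theta$-paths are $\theta$-homotopic if they are equivalent under the equivalence relation generated by lazifications and $\theta$-grid homotopies. The discrete fundamental group at scale $\theta$, denoted $\pi_{1,\theta}(X,x_0)$, is the group of $\theta$-homotopy classes of closed $\theta$-paths with endpoints $x_0$, with the operation of concatenation. Inverse limit. For $\theta'\leq\theta$ every $\theta'$-path is a $\theta$-path and every $\theta'$-homotopy is a $\theta$-homotopy, giving natural homomorphisms $\pi_{1,\theta'}(X,x_0)\to\pi_{1,\theta}(X,x_0)$; $\varprojlim_\theta\pi_{1,\theta}(X,x_0)$ is the inverse limit of this system over all $\theta>0$. Discretisation homomorphism. For a continuous path $\gamma\colon[0,1]\to X$ and times $0=t_0\leq t_1\leq\dots\leq t_n=1$, the $\theta$-path $(\gamma(t_0),\dots,\gamma(t_n))$ is a $\theta$-discretisation of $\gamma$ if $\gamma\bigl((t_{i-1},t_i)\bigr)\subseteq\overline B(\gamma(t_{i-1}),\theta)$ for every $i=1,\dots,n$. Every continuous path admits a $\theta$-discretisation, and sending the homotopy class of a loop $\gamma$ at $x_0$ to the $\theta$-homotopy class of any of its $\theta$-discretisations gives a well-defined homomorphism $\pi_1(X,x_0)\to\pi_{1,\theta}(X,x_0)$, compatible with the natural homomorphisms $\pi_{1,\theta'}(X,x_0)\to\pi_{1,\theta}(X,x_0)$ for $\theta'\leq\theta$. These induce the discretisation homomorphism $\pi_1(X,x_0)\to\varprojlim_\theta\pi_{1,\theta}(X,x_0)$. *)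

theory Defs
  imports "HOL-Analysis.Analysis" "HOL-Algebra.Product_Groups"
begin

text \<open>
  A metric space is rendered as a subset \<open>X\<close> of a type of class \<^class>\<open>metric_space\<close>, with the
  restricted metric; the open and closed balls of \<open>X\<close> are \<open>X \<inter> ball x r\<close> and \<open>X \<inter> cball x r\<close>.
\<close>

definition uniformly_locally_path_connected :: "'a::metric_space set \<Rightarrow> bool" where
  "uniformly_locally_path_connected X \<longleftrightarrow>
     (\<forall>\<epsilon>>0. \<exists>\<delta>>0. \<forall>x\<in>X. \<forall>y\<in>X \<inter> ball x \<delta>. \<forall>z\<in>X \<inter> ball x \<delta>.
        \<exists>g. path g \<and> path_image g \<subseteq> X \<inter> ball x \<epsilon> \<and> pathstart g = y \<and> pathfinish g = z)"

definition uniformly_semilocally_simply_connected :: "'a::metric_space set \<Rightarrow> bool" where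
  "uniformly_semilocally_simply_connected X \<longleftrightarrow>
     (\<exists>\<epsilon>>0. \<forall>x\<in>X. \<forall>g. path g \<and> path_image g \<subseteq> X \<inter> ball x \<epsilon> \<and> pathfinish g = pathstart g \<longrightarrow>
        homotopic_paths X g (\<lambda>_. pathstart g))"

definition loops_at :: "'a::metric_space set \<Rightarrow> 'a \<Rightarrow> (real \<Rightarrow> 'a) set" where
  "loops_at X x0 = {p. path p \<and> path_image p \<subseteq> X \<and> pathstart p = x0 \<and> pathfinish p = x0}"

definition homotopy_class :: "'a::metric_space set \<Rightarrow> (real \<Rightarrow> 'a) \<Rightarrow> (real \<Rightarrow> 'a) set" where
  "homotopy_class X p = {q. homotopic_paths X p q}"

definition fundamental_group :: "'a::metric_space set \<Rightarrow> 'a \<Rightarrow> (real \<Rightarrow> 'a) set monoid" where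
  "fundamental_group X x0 =
     \<lparr>carrier = homotopy_class X ` loops_at X x0,
      monoid.mult = (\<lambda>A B. \<Union>p\<in>A. \<Union>q\<in>B. homotopy_class X (p +++ q)),
      one = homotopy_class X (\<lambda>_. x0)\<rparr>"

text \<open>
  A map \<open>Z : [n] \<rightarrow> X\<close> is represented by the list \<open>[Z 0, \<dots>, Z n]\<close>, of length \<open>n + 1\<close>.
\<close>

definition theta_path :: "real \<Rightarrow> 'a::metric_space set \<Rightarrow> 'a list \<Rightarrow> bool" where
  "theta_path \<theta> X Z \<longleftrightarrow> Z \<noteq> [] \<and> set Z \<subseteq> X \<and>
     (\<forall>i. Suc i < length Z \<longrightarrow> dist (Z ! i) (Z ! Suc i) \<le> \<theta>)"

definition lazification :: "'a list \<Rightarrow> 'a list \<Rightarrow> bool" where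
  "lazification Z Z' \<longleftrightarrow> length Z < length Z' \<and>
     (\<exists>f. mono_on {..<length Z'} f \<and> f ` {..<length Z'} = {..<length Z} \<and>
        (\<forall>i<length Z'. Z' ! i = Z ! f i))"

definition theta_grid_homotopy ::
    "real \<Rightarrow> 'a::metric_space set \<Rightarrow> 'a list \<Rightarrow> 'a list \<Rightarrow> nat \<Rightarrow> (nat \<Rightarrow> nat \<Rightarrow> 'a) \<Rightarrow> bool" where
  "theta_grid_homotopy \<theta> X Z1 Z2 m H \<longleftrightarrow>
     (\<exists>n. length Z1 = Suc n \<and> length Z2 = Suc n \<and>
        (\<forall>i\<le>n. \<forall>t\<le>m. H i t \<in> X) \<and>
        (\<forall>i\<le>n. \<forall>i'\<le>n. \<forall>t\<le>m. \<forall>t'\<le>m.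
           dist (H i t) (H i' t') \<le> \<theta> * (\<bar>real i - real i'\<bar> + \<bar>real t - real t'\<bar>)) \<and>
        (\<forall>i\<le>n. H i 0 = Z1 ! i) \<and> (\<forall>i\<le>n. H i m = Z2 ! i) \<and>
        (\<forall>t\<le>m. H 0 t = Z1 ! 0 \<and> H 0 t = Z2 ! 0 \<and> H n t = Z1 ! n \<and> H n t = Z2 ! n))"

definition theta_step :: "real \<Rightarrow> 'a::metric_space set \<Rightarrow> 'a list \<Rightarrow> 'a list \<Rightarrow> bool" where
  "theta_step \<theta> X Z W \<longleftrightarrow> theta_path \<theta> X Z \<and> theta_path \<theta> X W \<and>
     (lazification Z W \<or> (\<exists>m H. theta_grid_homotopy \<theta> X Z W m H))"

definition theta_homotopic :: "real \<Rightarrow> 'a::metric_space set \<Rightarrow> 'a list \<Rightarrow> 'a list \<Rightarrow> bool" where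
  "theta_homotopic \<theta> X = equivclp (theta_step \<theta> X)"

definition theta_loops_at :: "real \<Rightarrow> 'a::metric_space set \<Rightarrow> 'a \<Rightarrow> 'a list set" where
  "theta_loops_at \<theta> X x0 = {Z. theta_path \<theta> X Z \<and> hd Z = x0 \<and> last Z = x0}"

definition theta_class :: "real \<Rightarrow> 'a::metric_space set \<Rightarrow> 'a list \<Rightarrow> 'a list set" where
  "theta_class \<theta> X Z = {W. theta_homotopic \<theta> X Z W}"

text \<open>
  Concatenation identifies the last point of the first \<open>\<theta>\<close>-path with the first point of the second.
\<close>

definition discrete_fundamental_group ::
    "'a::metric_space set \<Rightarrow> 'a \<Rightarrow> real \<Rightarrow> 'a list set monoid" where
  "discrete_fundamental_group X x0 \<theta> =
     \<lparr>carrier = theta_class \<theta> X ` theta_loops_at \<theta> X x0,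
      monoid.mult = (\<lambda>A B. \<Union>Z\<in>A. \<Union>W\<in>B. theta_class \<theta> X (Z @ tl W)),
      one = theta_class \<theta> X [x0]\<rparr>"

text \<open>
  The homomorphism induced by regarding \<open>\<theta>'\<close>-paths as \<open>\<theta>\<close>-paths, for \<open>\<theta>' \<le> \<theta>\<close>; the argument is
  a class at scale \<open>\<theta>'\<close>.
\<close>

definition scale_map :: "'a::metric_space set \<Rightarrow> real \<Rightarrow> 'a list set \<Rightarrow> 'a list set" where
  "scale_map X \<theta> A = (\<Union>Z\<in>A. theta_class \<theta> X Z)"

definition discrete_limit_group :: "'a::metric_space set \<Rightarrow> 'a \<Rightarrow> (real \<Rightarrow> 'a list set) monoid" where
  "discrete_limit_group X x0 =
     (let P = product_group {0<..} (discrete_fundamental_group X x0)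
      in P\<lparr>carrier := {c \<in> carrier P. \<forall>\<theta>' \<theta>. 0 < \<theta>' \<and> \<theta>' \<le> \<theta> \<longrightarrow> scale_map X \<theta> (c \<theta>') = c \<theta>}\<rparr>)"

definition theta_discretisation :: "real \<Rightarrow> (real \<Rightarrow> 'a::metric_space) \<Rightarrow> 'a list \<Rightarrow> bool" where
  "theta_discretisation \<theta> \<gamma> Z \<longleftrightarrow>
     (\<exists>ts. ts \<noteq> [] \<and> hd ts = 0 \<and> last ts = 1 \<and> sorted ts \<and> Z = map \<gamma> ts \<and>
        (\<forall>i. Suc i < length ts \<longrightarrow> \<gamma> ` {ts ! i<..<ts ! Suc i} \<subseteq> cball (\<gamma> (ts ! i)) \<theta>))"

text \<open>
  The value at scale \<open>\<theta>\<close> collects the \<open>\<theta>\<close>-homotopy classes of all \<open>\<theta>\<close>-discretisations of all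
  loops in the given class; it is a single class exactly because the map is well defined.
\<close>

definition discretisation_hom ::
    "'a::metric_space set \<Rightarrow> (real \<Rightarrow> 'a) set \<Rightarrow> (real \<Rightarrow> 'a list set)" where
  "discretisation_hom X A =
     (\<lambda>\<theta>\<in>{0<..}. \<Union>\<gamma>\<in>A. \<Union>Z\<in>{Z. theta_discretisation \<theta> \<gamma> Z}. theta_class \<theta> X Z)"

lemma theta_path_iff_lipschitz:
  "theta_path \<theta> X Z \<longleftrightarrow> Z \<noteq> [] \<and> set Z \<subseteq> X \<and>
     (\<forall>i<length Z. \<forall>j<length Z. dist (Z ! i) (Z ! j) \<le> \<theta> * \<bar>real i - real j\<bar>)"
  (is "?L \<longleftrightarrow> ?R")
proof
  assume L: ?L
  have *: "dist (Z ! i) (Z ! (i + k)) \<le> \<theta> * real k" if "i + k < length Z" for i k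
    using that
  proof (induction k)
    case 0
    then show ?case by simp
  next
    case (Suc k)
    have "dist (Z ! i) (Z ! (i + Suc k)) \<le>
        dist (Z ! i) (Z ! (i + k)) + dist (Z ! (i + k)) (Z ! (i + Suc k))"
      by (rule dist_triangle)
    also have "dist (Z ! (i + k)) (Z ! (i + Suc k)) \<le> \<theta>"
      using L Suc.prems by (simp add: theta_path_def)
    also have "dist (Z ! i) (Z ! (i + k)) \<le> \<theta> * real k"
      using Suc by simp
    finally show ?case
      by (simp add: algebra_simps)
  qed
  have "dist (Z ! i) (Z ! j) \<le> \<theta> * \<bar>real i - real j\<bar>"
    if "i < length Z" "j < length Z" for i j
  proof (cases "i \<le> j")
    case True
    then show ?thesis using *[of i "j - i"] that by (simp add: of_nat_diff)
  next
    case False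
    then show ?thesis using *[of j "i - j"] that by (simp add: of_nat_diff dist_commute)
  qed
  then show ?R using L by (simp add: theta_path_def)
next
  assume R: ?R
  have "dist (Z ! i) (Z ! Suc i) \<le> \<theta>" if "Suc i < length Z" for i
  proof -
    have "dist (Z ! i) (Z ! Suc i) \<le> \<theta> * \<bar>real i - real (Suc i)\<bar>"
      using R that Suc_lessD by blast
    then show ?thesis by simp
  qed
  then show ?L using R by (simp add: theta_path_def)
qed

lemma theta_homotopic_refl [simp]: "theta_homotopic \<theta> X Z Z"
  by (simp add: theta_homotopic_def equivclp_def)

lemma theta_homotopic_sym: "theta_homotopic \<theta> X Z W \<Longrightarrow> theta_homotopic \<theta> X W Z"
  unfolding theta_homotopic_def by (rule equivclp_sym)

lemma theta_homotopic_trans [trans]: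
  "theta_homotopic \<theta> X Z W \<Longrightarrow> theta_homotopic \<theta> X W V \<Longrightarrow> theta_homotopic \<theta> X Z V"
  unfolding theta_homotopic_def by (meson transpE transp_equivclp)

lemma theta_homotopic_step: "theta_step \<theta> X Z W \<Longrightarrow> theta_homotopic \<theta> X Z W"
  unfolding theta_homotopic_def by (simp add: r_into_equivclp)

lemma theta_class_eq_iff: "theta_class \<theta> X Z = theta_class \<theta> X W \<longleftrightarrow> theta_homotopic \<theta> X Z W"
  unfolding theta_class_def
  by (metis (no_types, lifting) mem_Collect_eq subsetI subset_antisym theta_homotopic_refl
      theta_homotopic_sym theta_homotopic_trans)

lemma lazification_ends:
  assumes "lazification Z Z'" "Z \<noteq> []"
  shows "hd Z' = hd Z" "last Z' = last Z"
proof -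
  obtain f where f: "mono_on {..<length Z'} f" "f ` {..<length Z'} = {..<length Z}"
      "\<And>i. i < length Z' \<Longrightarrow> Z' ! i = Z ! f i" and len: "length Z < length Z'"
    using assms(1) by (auto simp: lazification_def)
  have Z': "Z' \<noteq> []" using len by auto
  obtain i where i: "i < length Z'" "f i = 0"
    using f(2) assms(2) by (metis imageE length_greater_0_conv lessThan_iff)
  have "f 0 \<le> f i" using f(1) i by (intro mono_onD[OF f(1)]) auto
  then show "hd Z' = hd Z" using f(3)[of 0] i Z' assms(2) by (simp add: hd_conv_nth)
  obtain j where j: "j < length Z'" "f j = length Z - 1"
    using f(2) assms(2)
    by (metis diff_less imageE length_greater_0_conv lessThan_iff zero_less_one)
  have "f j \<le> f (length Z' - 1)" using j by (intro mono_onD[OF f(1)]) auto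
  moreover have "f (length Z' - 1) < length Z" using f(2) Z' by fastforce
  ultimately have "f (length Z' - 1) = length Z - 1" using j by linarith
  then show "last Z' = last Z" using f(3)[of "length Z' - 1"] Z' assms(2)
    by (simp add: last_conv_nth)
qed

lemma theta_step_ends:
  assumes "theta_step \<theta> X Z W"
  shows "hd W = hd Z" "last W = last Z"
proof -
  have ne: "Z \<noteq> []" "W \<noteq> []" using assms by (auto simp: theta_step_def theta_path_def)
  have "hd W = hd Z \<and> last W = last Z"
    if "theta_grid_homotopy \<theta> X Z W m H" for m H
    using that ne unfolding theta_grid_homotopy_def hd_conv_nth[OF ne(1)] hd_conv_nth[OF ne(2)]
      last_conv_nth[OF ne(1)] last_conv_nth[OF ne(2)]
    by (metis diff_Suc_1 le_refl)
  then show "hd W = hd Z" "last W = last Z"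
    using assms lazification_ends ne unfolding theta_step_def by blast+
qed

lemma theta_homotopic_theta_path:
  assumes "theta_homotopic \<theta> X Z W" "theta_path \<theta> X Z"
  shows "theta_path \<theta> X W \<and> hd W = hd Z \<and> last W = last Z"
  using assms(1) unfolding theta_homotopic_def
proof (induction rule: equivclp_induct)
  case base
  then show ?case using assms(2) by simp
next
  case (step y z)
  then show ?case by (metis theta_step_def theta_step_ends)
qed

lemma theta_path_mono: "theta_path \<theta>' X Z \<Longrightarrow> \<theta>' \<le> \<theta> \<Longrightarrow> theta_path \<theta> X Z"
  unfolding theta_path_def by (meson order_trans)

lemma theta_homotopic_mono:
  assumes "theta_homotopic \<theta>' X Z W" "\<theta>' \<le> \<theta>"
  shows "theta_homotopic \<theta> X Z W"
proof -
  have path: "theta_path \<theta> X Z" if "theta_path \<theta>' X Z" for Z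
    using that assms(2) by (rule theta_path_mono)
  have grid: "theta_grid_homotopy \<theta> X Z W m H" if "theta_grid_homotopy \<theta>' X Z W m H" for Z W m H
  proof -
    have "\<theta>' * (\<bar>real i - real i'\<bar> + \<bar>real t - real t'\<bar>) \<le>
        \<theta> * (\<bar>real i - real i'\<bar> + \<bar>real t - real t'\<bar>)" for i i' t t'
      using assms(2) by (intro mult_right_mono) auto
    then have le: "dist (H i t) (H i' t') \<le> \<theta> * (\<bar>real i - real i'\<bar> + \<bar>real t - real t'\<bar>)"
      if "dist (H i t) (H i' t') \<le> \<theta>' * (\<bar>real i - real i'\<bar> + \<bar>real t - real t'\<bar>)" for i i' t t'
      using that by (rule order_trans[rotated])
    obtain n where n: "length Z = Suc n" "length W = Suc n"
      and HX: "\<forall>i\<le>n. \<forall>t\<le>m. H i t \<in> X"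
      and Hd: "\<forall>i\<le>n. \<forall>i'\<le>n. \<forall>t\<le>m. \<forall>t'\<le>m.
             dist (H i t) (H i' t') \<le> \<theta>' * (\<bar>real i - real i'\<bar> + \<bar>real t - real t'\<bar>)"
      and H0: "\<forall>i\<le>n. H i 0 = Z ! i"
      and Hm: "\<forall>i\<le>n. H i m = W ! i"
      and Hs: "\<forall>t\<le>m. H 0 t = Z ! 0 \<and> H 0 t = W ! 0 \<and> H n t = Z ! n \<and> H n t = W ! n"
      using \<open>theta_grid_homotopy \<theta>' X Z W m H\<close> unfolding theta_grid_homotopy_def
      by (elim exE conjE) (rule that)
    have "\<forall>i\<le>n. \<forall>i'\<le>n. \<forall>t\<le>m. \<forall>t'\<le>m.
        dist (H i t) (H i' t') \<le> \<theta> * (\<bar>real i - real i'\<bar> + \<bar>real t - real t'\<bar>)"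
      using Hd le by blast
    then show ?thesis unfolding theta_grid_homotopy_def
      using n HX H0 Hm Hs by (intro exI[of _ n] conjI)
  qed
  have "theta_step \<theta> X Z W" if "theta_step \<theta>' X Z W" for Z W
    using that path grid unfolding theta_step_def by blast
  then show ?thesis using assms(1) unfolding theta_homotopic_def equivclp_def
    by (metis (mono_tags, lifting) rtranclp_mono predicate2D predicate2I symclp_def)
qed

lemma theta_path_append:
  assumes "theta_path \<theta> X Z" "theta_path \<theta> X W" "last Z = hd W"
  shows "theta_path \<theta> X (Z @ tl W)" "hd (Z @ tl W) = hd Z" "last (Z @ tl W) = last W"
proof -
  have ne: "Z \<noteq> []" "W \<noteq> []" using assms by (auto simp: theta_path_def)
  show "hd (Z @ tl W) = hd Z" using ne by simp
  show "last (Z @ tl W) = last W"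
    using ne assms(3) by (cases W) (auto simp: last_append)
  have "dist ((Z @ tl W) ! i) ((Z @ tl W) ! Suc i) \<le> \<theta>" if i: "Suc i < length (Z @ tl W)" for i
  proof -
    consider "Suc i < length Z" | "Suc i = length Z" | "length Z \<le> i" by linarith
    then show ?thesis
    proof cases
      case 1
      then show ?thesis using assms(1) by (simp add: theta_path_def nth_append)
    next
      case 2
      then have "Z ! i = W ! 0"
        using assms(3) ne by (simp add: last_conv_nth hd_conv_nth flip: 2)
      moreover have "dist (W ! 0) (W ! Suc 0) \<le> \<theta>"
        using assms(2) i 2 by (auto simp: theta_path_def)
      ultimately show ?thesis using 2 i by (simp add: nth_append nth_tl)
    next
      case 3
      have "dist (W ! Suc (i - length Z)) (W ! Suc (Suc (i - length Z))) \<le> \<theta>"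
        using assms(2) i 3 by (auto simp: theta_path_def)
      then show ?thesis using 3 i by (simp add: nth_append nth_tl Suc_diff_le)
    qed
  qed
  moreover have "set (Z @ tl W) \<subseteq> X"
    using assms(1,2) by (auto simp: theta_path_def dest: list.set_sel(2))
  ultimately show "theta_path \<theta> X (Z @ tl W)" using ne by (simp add: theta_path_def)
qed

lemma theta_path_rev:
  assumes "theta_path \<theta> X Z"
  shows "theta_path \<theta> X (rev Z)"
  unfolding theta_path_def
proof (intro conjI allI impI)
  fix i assume i: "Suc i < length (rev Z)"
  define k where "k = length Z - Suc (Suc i)"
  have "Suc k = length Z - Suc i" using i by (simp add: k_def)
  then have "rev Z ! i = Z ! Suc k" "rev Z ! Suc i = Z ! k" "Suc k < length Z"
    using i by (simp_all add: rev_nth k_def)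
  then show "dist (rev Z ! i) (rev Z ! Suc i) \<le> \<theta>"
    using assms by (simp add: theta_path_def dist_commute)
qed (use assms in \<open>auto simp: theta_path_def\<close>)

lemma lazification_rev:
  assumes "lazification Z W"
  shows "lazification (rev Z) (rev W)"
proof -
  obtain f where f: "mono_on {..<length W} f" "f ` {..<length W} = {..<length Z}"
      "\<And>i. i < length W \<Longrightarrow> W ! i = Z ! f i" and len: "length Z < length W"
    using assms by (auto simp: lazification_def)
  define g where "g i = length Z - Suc (f (length W - Suc i))" for i
  have flt: "f i < length Z" if "i < length W" for i using f(2) that by blast
  have "mono_on {..<length W} g"
    unfolding g_def by (intro mono_onI diff_le_mono2 Suc_le_mono[THEN iffD2] mono_onD[OF f(1)]) auto
  moreover have "g ` {..<length W} = {..<length Z}"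
  proof (intro equalityI subsetI)
    fix k assume "k \<in> g ` {..<length W}"
    then obtain i where "i < length W" "k = g i" by auto
    then have "f (length W - Suc i) < length Z" by (intro flt) auto
    then show "k \<in> {..<length Z}" using \<open>k = g i\<close> by (auto simp: g_def)
  next
    fix k assume k: "k \<in> {..<length Z}"
    then have "length Z - Suc k \<in> f ` {..<length W}" using f(2) by auto
    then obtain j where j: "j < length W" "f j = length Z - Suc k" by auto
    then have "k = g (length W - Suc j)" using k by (auto simp: g_def)
    then show "k \<in> g ` {..<length W}" using j by auto
  qed
  moreover have "rev W ! i = rev Z ! g i" if i: "i < length W" for i
  proof -
    have lt: "f (length W - Suc i) < length Z" using i by (intro flt) auto
    then have "rev Z ! g i = Z ! f (length W - Suc i)"
      by (simp add: rev_nth g_def)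
    then show ?thesis using f(3)[of "length W - Suc i"] i by (simp add: rev_nth)
  qed
  ultimately show ?thesis using len by (auto simp: lazification_def)
qed

lemma theta_grid_homotopy_rev:
  assumes "theta_grid_homotopy \<theta> X Z W m H"
  shows "theta_grid_homotopy \<theta> X (rev Z) (rev W) m (\<lambda>i. H (length Z - Suc i))"
proof -
  obtain n where n: "length Z = Suc n" "length W = Suc n"
    and HX: "\<forall>i\<le>n. \<forall>t\<le>m. H i t \<in> X"
    and Hd: "\<forall>i\<le>n. \<forall>i'\<le>n. \<forall>t\<le>m. \<forall>t'\<le>m.
           dist (H i t) (H i' t') \<le> \<theta> * (\<bar>real i - real i'\<bar> + \<bar>real t - real t'\<bar>)"
    and H0: "\<forall>i\<le>n. H i 0 = Z ! i"
    and Hm: "\<forall>i\<le>n. H i m = W ! i"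
    and Hs: "\<forall>t\<le>m. H 0 t = Z ! 0 \<and> H 0 t = W ! 0 \<and> H n t = Z ! n \<and> H n t = W ! n"
    using assms unfolding theta_grid_homotopy_def by (elim exE conjE) (rule that)
  note HX = HX[rule_format] and Hd = Hd[rule_format] and H0 = H0[rule_format] and Hm = Hm[rule_format]
    and Hs = Hs[rule_format]
  have d: "dist (H (n - i) t) (H (n - i') t') \<le> \<theta> * (\<bar>real i - real i'\<bar> + \<bar>real t - real t'\<bar>)"
    if "i \<le> n" "i' \<le> n" "t \<le> m" "t' \<le> m" for i i' t t'
    using Hd[of "n - i" "n - i'" t t'] that by (simp add: of_nat_diff abs_minus_commute)
  show ?thesis unfolding theta_grid_homotopy_def
  proof (intro exI[of _ n] conjI allI impI)
    fix t assume "t \<le> m"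
    then show "H (length Z - Suc 0) t = rev Z ! 0" "H (length Z - Suc 0) t = rev W ! 0"
      "H (length Z - Suc n) t = rev Z ! n" "H (length Z - Suc n) t = rev W ! n"
      using Hs[of t] n rev_nth[of 0 Z] rev_nth[of 0 W] rev_nth[of n Z] rev_nth[of n W]
      by (metis diff_Suc_Suc diff_self_eq_0 diff_zero lessI zero_less_Suc)+
  qed (use n in \<open>auto simp: HX d H0 Hm rev_nth\<close>)
qed

lemma theta_homotopic_rev:
  assumes "theta_homotopic \<theta> X Z W"
  shows "theta_homotopic \<theta> X (rev Z) (rev W)"
proof -
  have *: "theta_step \<theta> X (rev Z) (rev W)" if "theta_step \<theta> X Z W" for Z W
    using that theta_path_rev lazification_rev theta_grid_homotopy_rev
    unfolding theta_step_def by blast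
  show ?thesis using assms unfolding theta_homotopic_def
  proof (induction rule: equivclp_induct)
    case base
    then show ?case by (simp add: equivclp_def)
  next
    case (step y z)
    then show ?case using * by (metis equivclp_into_equivclp)
  qed
qed

lemma nth_append_tl:
  assumes "Z \<noteq> []" "W \<noteq> []" "last Z = hd W" "i < length Z + length W - 1"
  shows "(Z @ tl W) ! i = (if i < length Z then Z ! i else W ! (i - (length Z - 1)))"
    and "length Z - 1 \<le> i \<Longrightarrow> (Z @ tl W) ! i = W ! (i - (length Z - 1))"
proof -
  show 1: "(Z @ tl W) ! i = (if i < length Z then Z ! i else W ! (i - (length Z - 1)))"
  proof (cases "i < length Z")
    case True
    then show ?thesis by (simp add: nth_append)
  next
    case False
    then have "Suc (i - length Z) = i - (length Z - 1)" using assms(1) by (cases Z) auto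
    then show ?thesis using False assms by (simp add: nth_append nth_tl)
  qed
  show "(Z @ tl W) ! i = W ! (i - (length Z - 1))" if "length Z - 1 \<le> i"
  proof (cases "i < length Z")
    case True
    then have "i = length Z - 1" using that by simp
    then show ?thesis using 1 True assms by (simp add: last_conv_nth hd_conv_nth)
  qed (use 1 in auto)
qed

lemma lazification_append:
  assumes "lazification Z Z'" "Z \<noteq> []" "W \<noteq> []" "last Z = hd W"
  shows "lazification (Z @ tl W) (Z' @ tl W)"
proof -
  obtain f where f: "mono_on {..<length Z'} f" "f ` {..<length Z'} = {..<length Z}"
      "\<And>i. i < length Z' \<Longrightarrow> Z' ! i = Z ! f i" and len: "length Z < length Z'"
    using assms(1) by (auto simp: lazification_def)
  define g where
    "g i = (if i < length Z' then f i else length Z - 1 + (i - (length Z' - 1)))" for i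
  have ends: "last Z' = hd W" "Z' \<noteq> []" using lazification_ends[OF assms(1,2)] assms len by auto
  have flt: "f i < length Z" if "i < length Z'" for i using f(2) that by blast
  let ?m = "length (Z' @ tl W)" and ?n = "length (Z @ tl W)"
  have m: "?m = length Z' + length W - 1" and n: "?n = length Z + length W - 1"
    using assms by (cases W; simp)+
  have "mono_on {..<?m} g"
  proof (rule mono_onI)
    fix i j assume "i \<in> {..<?m}" "j \<in> {..<?m}" "i \<le> j"
    then show "g i \<le> g j"
      using flt[of i] by (auto simp: g_def intro!: mono_onD[OF f(1)])
  qed
  moreover have "g ` {..<?m} = {..<?n}"
  proof (intro equalityI subsetI)
    fix k assume "k \<in> g ` {..<?m}"
    then obtain i where i: "i < ?m" "k = g i" by auto
    show "k \<in> {..<?n}"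
    proof (cases "i < length Z'")
      case True
      then show ?thesis using flt[of i] i by (simp add: g_def)
    next
      case False
      then show ?thesis using i assms(2) ends(2) unfolding m n g_def
        by (cases Z; cases Z'; cases W) auto
    qed
  next
    fix k assume k: "k \<in> {..<?n}"
    show "k \<in> g ` {..<?m}"
    proof (cases "k < length Z")
      case True
      then have "k \<in> f ` {..<length Z'}" using f(2) by simp
      then obtain j where "j < length Z'" "f j = k" by auto
      then show ?thesis by (intro image_eqI[of _ _ j]) (auto simp: g_def)
    next
      case False
      then have "k = g (length Z' - 1 + (k - (length Z - 1)))"
        using assms(2) len by (cases Z) (auto simp: g_def)
      moreover have "length Z' - 1 + (k - (length Z - 1)) < ?m"
        using k False assms(2) len unfolding m n by auto
      ultimately show ?thesis by blast
    qed
  qed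
  moreover have "(Z' @ tl W) ! i = (Z @ tl W) ! g i" if i: "i < ?m" for i
  proof (cases "i < length Z'")
    case True
    then show ?thesis using flt[of i] f(3)[of i] by (simp add: g_def nth_append)
  next
    case False
    have 1: "(Z' @ tl W) ! i = W ! (i - (length Z' - 1))"
      using False i m assms ends by (intro nth_append_tl(2)) auto
    have "g i < length Z + length W - 1"
      using False i m assms(2) len by (cases Z) (auto simp: g_def)
    then have "(Z @ tl W) ! g i = W ! (g i - (length Z - 1))"
      using False assms by (intro nth_append_tl(2)) (auto simp: g_def)
    then show ?thesis using 1 False by (simp add: g_def)
  qed
  ultimately show ?thesis using len by (auto simp: lazification_def)
qed

lemma theta_grid_homotopy_append:
  assumes H: "theta_grid_homotopy \<theta> X Z Z' m H" and W: "theta_path \<theta> X W"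
    and ends: "last Z = hd W" and "0 \<le> \<theta>"
  shows "theta_grid_homotopy \<theta> X (Z @ tl W) (Z' @ tl W) m
           (\<lambda>i t. if i < length Z then H i t else W ! (i - (length Z - 1)))"
proof -
  obtain n where n: "length Z = Suc n" "length Z' = Suc n"
    and HX: "\<forall>i\<le>n. \<forall>t\<le>m. H i t \<in> X"
    and Hd: "\<forall>i\<le>n. \<forall>i'\<le>n. \<forall>t\<le>m. \<forall>t'\<le>m.
           dist (H i t) (H i' t') \<le> \<theta> * (\<bar>real i - real i'\<bar> + \<bar>real t - real t'\<bar>)"
    and H0: "\<forall>i\<le>n. H i 0 = Z ! i"
    and Hm: "\<forall>i\<le>n. H i m = Z' ! i"
    and Hs: "\<forall>t\<le>m. H 0 t = Z ! 0 \<and> H 0 t = Z' ! 0 \<and> H n t = Z ! n \<and> H n t = Z' ! n"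
    using H unfolding theta_grid_homotopy_def by (elim exE conjE) (rule that)
  note HX = HX[rule_format] and Hd = Hd[rule_format] and H0 = H0[rule_format] and Hm = Hm[rule_format]
    and Hs = Hs[rule_format]
  have ne: "Z \<noteq> []" "Z' \<noteq> []" "W \<noteq> []" using n W by (auto simp: theta_path_def)
  have Wd: "dist (W ! i) (W ! j) \<le> \<theta> * \<bar>real i - real j\<bar>" if "i < length W" "j < length W" for i j
    using W that by (simp add: theta_path_iff_lipschitz)
  have Zn: "Z ! n = W ! 0" "Z' ! n = W ! 0"
    using ends ne n Hs[of 0] last_conv_nth[OF ne(1)] hd_conv_nth[OF ne(3)]
    by (metis diff_Suc_1 le0)+
  have Z0: "Z' ! 0 = Z ! 0" using Hs[of 0] by auto
  obtain k where k: "length W = Suc k" using ne by (cases W) auto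
  define G where "G i t = (if i < length Z then H i t else W ! (i - (length Z - 1)))" for i t
  have Gle: "G i t = H i t" if "i \<le> n" for i t using that n by (simp add: G_def)
  have Ggt: "G i t = W ! (i - n)" if "n \<le> i" "t \<le> m" for i t
    using that n Hs[of t] Zn by (cases "i = n") (auto simp: G_def)
  have mixed: "dist (G i t) (G i' t') \<le> \<theta> * (\<bar>real i - real i'\<bar> + \<bar>real t - real t'\<bar>)"
    if "i \<le> n" "n \<le> i'" "i' \<le> n + k" "t \<le> m" "t' \<le> m" for i i' t t'
  proof -
    have "dist (G i t) (G i' t') \<le> dist (G i t) (G n t') + dist (G n t') (G i' t')"
      by (rule dist_triangle)
    also have "dist (G i t) (G n t') \<le> \<theta> * (\<bar>real i - real n\<bar> + \<bar>real t - real t'\<bar>)"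
      using that Hd[of i n t t'] by (simp add: Gle)
    also have "dist (G n t') (G i' t') \<le> \<theta> * \<bar>real 0 - real (i' - n)\<bar>"
      using that k Wd[of 0 "i' - n"] Ggt[of n t'] Ggt[of i' t'] by simp
    finally show ?thesis using that by (simp add: of_nat_diff algebra_simps)
  qed
  have dist: "dist (G i t) (G i' t') \<le> \<theta> * (\<bar>real i - real i'\<bar> + \<bar>real t - real t'\<bar>)"
    if b: "i \<le> n + k" "i' \<le> n + k" "t \<le> m" "t' \<le> m" for i i' t t'
  proof -
    consider "i \<le> n" "i' \<le> n" | "i \<le> n" "n \<le> i'" | "n \<le> i" "i' \<le> n" | "n \<le> i" "n \<le> i'"
      by linarith
    then show ?thesis
    proof cases
      case 1
      then show ?thesis using b by (simp add: Gle Hd)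
    next
      case 2
      then show ?thesis using b mixed by simp
    next
      case 3
      then show ?thesis using b mixed[of i' i t' t]
        by (simp add: dist_commute abs_minus_commute)
    next
      case 4
      have "dist (G i t) (G i' t') \<le> \<theta> * \<bar>real (i - n) - real (i' - n)\<bar>"
        using 4 b k Wd[of "i - n" "i' - n"] Ggt[of i t] Ggt[of i' t'] by simp
      also have "\<dots> \<le> \<theta> * (\<bar>real i - real i'\<bar> + \<bar>real t - real t'\<bar>)"
        using 4 \<open>0 \<le> \<theta>\<close> by (intro mult_left_mono) (auto simp: of_nat_diff)
      finally show ?thesis .
    qed
  qed
  have GX: "G i t \<in> X" if "i \<le> n + k" "t \<le> m" for i t
    using that HX W k n unfolding G_def theta_path_def
    by (auto simp: less_Suc_eq_le subset_iff)
  have ends0: "(Z @ tl W) ! i = (if i \<le> n then Z ! i else W ! (i - n))"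
    and endsm: "(Z' @ tl W) ! i = (if i \<le> n then Z' ! i else W ! (i - n))" if "i \<le> n + k" for i
    using that nth_append_tl(1)[of Z W i] nth_append_tl(1)[of Z' W i] ne ends n k Zn
    by (auto simp: last_conv_nth hd_conv_nth less_Suc_eq_le)
  have "theta_grid_homotopy \<theta> X (Z @ tl W) (Z' @ tl W) m G"
    unfolding theta_grid_homotopy_def
  proof (intro exI[of _ "n + k"] conjI allI impI)
    show "length (Z @ tl W) = Suc (n + k)" "length (Z' @ tl W) = Suc (n + k)"
      using n k by auto
  qed (auto simp: GX dist ends0 endsm Gle H0 Hm Ggt Hs Zn Z0)
  then show ?thesis unfolding G_def .
qed

lemma theta_homotopic_append_right:
  assumes "theta_homotopic \<theta> X Z Z'" "theta_path \<theta> X Z" "theta_path \<theta> X W" "last Z = hd W" "0 \<le> \<theta>"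
  shows "theta_homotopic \<theta> X (Z @ tl W) (Z' @ tl W)"
proof -
  have step: "theta_step \<theta> X (Z @ tl W) (Z' @ tl W)"
    if s: "theta_step \<theta> X Z Z'" "last Z = hd W" for Z Z'
  proof -
    have "theta_path \<theta> X (Z @ tl W)" "theta_path \<theta> X (Z' @ tl W)"
      using s assms(3) theta_step_ends[OF s(1)] by (auto simp: theta_step_def theta_path_append)
    moreover have "Z \<noteq> []" "W \<noteq> []" using s(1) assms(3) by (auto simp: theta_step_def theta_path_def)
    ultimately show ?thesis
      using s lazification_append theta_grid_homotopy_append[OF _ assms(3) s(2) assms(5)]
      unfolding theta_step_def by blast
  qed
  show ?thesis using assms(1) unfolding theta_homotopic_def
  proof (induction rule: equivclp_induct)
    case base
    then show ?case by (simp add: equivclp_def)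
  next
    case (step y z)
    have "last y = hd W"
      using step(1) assms(2,4) theta_homotopic_theta_path unfolding theta_homotopic_def by fastforce
    moreover from this have "last z = hd W"
      using step(2) theta_step_ends by metis
    ultimately have "equivclp (theta_step \<theta> X) (y @ tl W) (z @ tl W)"
      using step(2) \<open>\<And>Z' Z. \<lbrakk>theta_step \<theta> X Z Z'; last Z = hd W\<rbrakk> \<Longrightarrow> theta_step \<theta> X (Z @ tl W) (Z' @ tl W)\<close>
      by (metis equivclp_sym r_into_equivclp)
    then show ?case using step(3) by (meson transpE transp_equivclp)
  qed
qed

lemma rev_append_tl:
  assumes "Z \<noteq> []" "W \<noteq> []" "last Z = hd W"
  shows "rev (Z @ tl W) = rev W @ tl (rev Z)"
  using assms by (cases W; cases Z rule: rev_cases) auto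

lemma theta_homotopic_append:
  assumes "theta_homotopic \<theta> X Z Z'" "theta_homotopic \<theta> X W W'"
    and "theta_path \<theta> X Z" "theta_path \<theta> X W" "last Z = hd W" "0 \<le> \<theta>"
  shows "theta_homotopic \<theta> X (Z @ tl W) (Z' @ tl W')"
proof -
  note Z' = theta_homotopic_theta_path[OF assms(1,3)] and W' = theta_homotopic_theta_path[OF assms(2,4)]
  have ne: "Z' \<noteq> []" "W \<noteq> []" "W' \<noteq> []" using Z' W' assms(4) by (auto simp: theta_path_def)
  have "theta_homotopic \<theta> X (rev W @ tl (rev Z')) (rev W' @ tl (rev Z'))"
    using ne assms Z' by (intro theta_homotopic_append_right theta_homotopic_rev theta_path_rev)
      (auto simp: last_rev hd_rev)
  then have "theta_homotopic \<theta> X (rev (Z' @ tl W)) (rev (Z' @ tl W'))"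
    using ne Z' W' assms(5) rev_append_tl[of Z' W] rev_append_tl[of Z' W'] by metis
  then have "theta_homotopic \<theta> X (Z' @ tl W) (Z' @ tl W')"
    using theta_homotopic_rev by (metis rev_rev_ident)
  then show ?thesis
    by (rule theta_homotopic_trans[OF theta_homotopic_append_right[OF assms(1,3,4,5,6)]])
qed

lemma theta_homotopic_rinv:
  assumes Z: "theta_path \<theta> X Z" and "0 \<le> \<theta>"
  shows "theta_homotopic \<theta> X (Z @ tl (rev Z)) [hd Z]"
proof -
  obtain n where n: "length Z = Suc n" using Z by (cases Z) (auto simp: theta_path_def)
  have ne: "Z \<noteq> []" using n by auto
  have Zd: "dist (Z ! i) (Z ! j) \<le> \<theta> * \<bar>real i - real j\<bar>" if "i \<le> n" "j \<le> n" for i j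
    using Z that n by (simp add: theta_path_iff_lipschitz)
  have x0: "hd Z \<in> X" using Z by (cases Z) (auto simp: theta_path_def)
  define x where "x = hd Z"
  define H where "H i t = Z ! min (min i (2 * n - i)) (n - t)" for i t
  let ?W = "replicate (Suc (2 * n)) x"
  have nth: "(Z @ tl (rev Z)) ! i = Z ! min i (2 * n - i)" if "i \<le> 2 * n" for i
  proof -
    have "(Z @ tl (rev Z)) ! i = (if i < length Z then Z ! i else rev Z ! (i - (length Z - 1)))"
      using that n ne by (intro nth_append_tl(1)) (auto simp: hd_rev)
    also have "\<dots> = Z ! min i (2 * n - i)"
      using that n by (auto simp: rev_nth min_def mult_2)
    finally show ?thesis .
  qed
  have Z0: "Z ! 0 = x" using ne by (simp add: hd_conv_nth x_def)
  have "theta_grid_homotopy \<theta> X (Z @ tl (rev Z)) ?W n H"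
    unfolding theta_grid_homotopy_def
  proof (intro exI[of _ "2 * n"] conjI allI impI)
    fix i i' t t' assume b: "i \<le> 2 * n" "i' \<le> 2 * n" "t \<le> n" "t' \<le> n"
    let ?a = "min (min i (2 * n - i)) (n - t)" and ?b = "min (min i' (2 * n - i')) (n - t')"
    have "dist (H i t) (H i' t') \<le> \<theta> * \<bar>real ?a - real ?b\<bar>"
      unfolding H_def by (rule Zd) auto
    also have "\<dots> \<le> \<theta> * (\<bar>real i - real i'\<bar> + \<bar>real t - real t'\<bar>)"
    proof (rule mult_left_mono[OF _ \<open>0 \<le> \<theta>\<close>])
      have min: "\<bar>real (min p q) - real (min p' q')\<bar> \<le> \<bar>real p - real p'\<bar> + \<bar>real q - real q'\<bar>"
        for p q p' q' by (simp add: min_def) linarith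
      have fold: "real (min j (2 * n - j)) = real n - \<bar>real n - real j\<bar>" if "j \<le> 2 * n" for j
        using that by (simp add: min_def of_nat_diff)
      have "\<bar>real (min i (2 * n - i)) - real (min i' (2 * n - i'))\<bar> \<le> \<bar>real i - real i'\<bar>"
        using b by (simp add: fold)
      moreover have "\<bar>real (n - t) - real (n - t')\<bar> = \<bar>real t - real t'\<bar>"
        using b by (simp add: of_nat_diff)
      ultimately show "\<bar>real ?a - real ?b\<bar> \<le> \<bar>real i - real i'\<bar> + \<bar>real t - real t'\<bar>"
        using min[of "min i (2 * n - i)" "n - t" "min i' (2 * n - i')" "n - t'"] by linarith
    qed
    finally show "dist (H i t) (H i' t') \<le> \<theta> * (\<bar>real i - real i'\<bar> + \<bar>real t - real t'\<bar>)" .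
  next
    fix i t assume "i \<le> 2 * n" "t \<le> n"
    show "H i t \<in> X" using Z n unfolding H_def theta_path_def
      by (auto simp: subset_iff min_def)
  next
    fix i assume i: "i \<le> 2 * n"
    then have "min (min i (2 * n - i)) (n - 0) = min i (2 * n - i)" by auto
    then show "H i 0 = (Z @ tl (rev Z)) ! i" using nth[OF i] by (simp add: H_def)
  qed (use n Z0 nth in \<open>auto simp: H_def nth_replicate simp del: replicate_Suc\<close>)
  moreover have "theta_path \<theta> X (Z @ tl (rev Z))"
    using Z theta_path_rev[OF Z] ne by (intro theta_path_append) (auto simp: hd_rev)
  moreover have W: "theta_path \<theta> X ?W"
    using x0 \<open>0 \<le> \<theta>\<close> unfolding theta_path_def by (auto simp: x_def nth_replicate simp del: replicate_Suc)
  ultimately have 1: "theta_homotopic \<theta> X (Z @ tl (rev Z)) ?W"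
    by (intro theta_homotopic_step) (auto simp: theta_step_def)
  have "theta_homotopic \<theta> X [x] ?W"
  proof (cases "n = 0")
    case False
    then have "lazification [x] ?W" unfolding lazification_def
      by (intro conjI exI[of _ "\<lambda>_. 0"]) (auto simp: nth_replicate mono_on_def simp del: replicate_Suc)
    moreover have "theta_path \<theta> X [x]" using x0 by (auto simp: theta_path_def x_def)
    ultimately show ?thesis using W by (intro theta_homotopic_step) (auto simp: theta_step_def)
  qed simp
  then show ?thesis unfolding x_def[symmetric]
    by (rule theta_homotopic_trans[OF 1 theta_homotopic_sym])
qed

lemma theta_loops_atD:
  assumes "Z \<in> theta_loops_at \<theta> X x0"
  shows "theta_path \<theta> X Z" "Z \<noteq> []" "hd Z = x0" "last Z = x0"
  using assms by (auto simp: theta_loops_at_def theta_path_def)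

lemma theta_loops_at_append:
  assumes "Z \<in> theta_loops_at \<theta> X x0" "W \<in> theta_loops_at \<theta> X x0"
  shows "Z @ tl W \<in> theta_loops_at \<theta> X x0"
  using assms theta_path_append[of \<theta> X Z W] by (simp add: theta_loops_at_def)

lemma discrete_fundamental_group_mult:
  assumes "Z \<in> theta_loops_at \<theta> X x0" "W \<in> theta_loops_at \<theta> X x0" "0 < \<theta>"
  shows "theta_class \<theta> X Z \<otimes>\<^bsub>discrete_fundamental_group X x0 \<theta>\<^esub> theta_class \<theta> X W =
         theta_class \<theta> X (Z @ tl W)"
proof -
  have "theta_class \<theta> X (Z' @ tl W') = theta_class \<theta> X (Z @ tl W)"
    if "Z' \<in> theta_class \<theta> X Z" "W' \<in> theta_class \<theta> X W" for Z' W'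
    using that theta_homotopic_append[of \<theta> X Z Z' W W'] assms theta_loops_atD
    unfolding theta_class_eq_iff
    by (smt (verit) mem_Collect_eq theta_class_def theta_homotopic_sym)
  moreover have "Z \<in> theta_class \<theta> X Z" "W \<in> theta_class \<theta> X W" by (auto simp: theta_class_def)
  ultimately show ?thesis unfolding discrete_fundamental_group_def monoid.simps
    by (intro UN_constant_eq[of Z] UN_constant_eq[of W] ballI)
qed

theorem group_discrete_fundamental_group:
  assumes "x0 \<in> X" "0 < \<theta>"
  shows "group (discrete_fundamental_group X x0 \<theta>)" (is "group ?G")
proof -
  let ?L = "theta_loops_at \<theta> X x0"
  have carr: "carrier ?G = theta_class \<theta> X ` ?L" and one: "\<one>\<^bsub>?G\<^esub> = theta_class \<theta> X [x0]"
    by (simp_all add: discrete_fundamental_group_def)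
  have const: "[x0] \<in> ?L" using assms by (auto simp: theta_loops_at_def theta_path_def)
  note mult = discrete_fundamental_group_mult[OF _ _ assms(2)] and app = theta_loops_at_append
  show ?thesis
  proof (rule groupI; unfold carr one)
    fix A B assume "A \<in> theta_class \<theta> X ` ?L" "B \<in> theta_class \<theta> X ` ?L"
    then show "A \<otimes>\<^bsub>?G\<^esub> B \<in> theta_class \<theta> X ` ?L" by (auto simp: mult app)
  next
    fix A B C
    assume "A \<in> theta_class \<theta> X ` ?L" "B \<in> theta_class \<theta> X ` ?L" "C \<in> theta_class \<theta> X ` ?L"
    then obtain Z W V where L: "Z \<in> ?L" "W \<in> ?L" "V \<in> ?L"
      "A = theta_class \<theta> X Z" "B = theta_class \<theta> X W" "C = theta_class \<theta> X V" by auto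
    then have "(Z @ tl W) @ tl V = Z @ tl (W @ tl V)" using theta_loops_atD(2)[OF L(2)] by simp
    then show "A \<otimes>\<^bsub>?G\<^esub> B \<otimes>\<^bsub>?G\<^esub> C = A \<otimes>\<^bsub>?G\<^esub> (B \<otimes>\<^bsub>?G\<^esub> C)"
      using L by (simp add: mult app)
  next
    fix A assume "A \<in> theta_class \<theta> X ` ?L"
    then obtain Z where Z: "Z \<in> ?L" "A = theta_class \<theta> X Z" by auto
    note Zp = theta_loops_atD[OF Z(1)]
    have "[x0] @ tl Z = Z" using Zp by (cases Z) auto
    then show "theta_class \<theta> X [x0] \<otimes>\<^bsub>?G\<^esub> A = A" using mult[OF const Z(1)] Z by simp
    have R: "rev Z \<in> ?L"
      using Zp by (auto simp: theta_loops_at_def theta_path_rev hd_rev last_rev)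
    have "theta_homotopic \<theta> X (rev Z @ tl (rev (rev Z))) [hd (rev Z)]"
      using theta_loops_atD(1)[OF R] assms by (intro theta_homotopic_rinv) auto
    then have "theta_class \<theta> X (rev Z @ tl Z) = theta_class \<theta> X [x0]"
      using Zp by (simp add: theta_class_eq_iff hd_rev)
    then show "\<exists>B\<in>theta_class \<theta> X ` ?L. B \<otimes>\<^bsub>?G\<^esub> A = theta_class \<theta> X [x0]"
      using mult[OF R Z(1)] R Z by auto
  qed (use const in auto)
qed

lemma scale_map_class:
  assumes "\<theta>' \<le> \<theta>"
  shows "scale_map X \<theta> (theta_class \<theta>' X Z) = theta_class \<theta> X Z"
proof -
  have "theta_class \<theta> X W = theta_class \<theta> X Z" if "W \<in> theta_class \<theta>' X Z" for W
  proof -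
    have "theta_homotopic \<theta> X Z W"
      using that assms theta_homotopic_mono by (auto simp: theta_class_def)
    then show ?thesis unfolding theta_class_eq_iff by (rule theta_homotopic_sym)
  qed
  moreover have "Z \<in> theta_class \<theta>' X Z" by (simp add: theta_class_def)
  ultimately show ?thesis unfolding scale_map_def by (intro UN_constant_eq[of Z] ballI)
qed

lemma scale_map_hom:
  assumes "0 < \<theta>'" "\<theta>' \<le> \<theta>"
  shows "scale_map X \<theta> \<in> hom (discrete_fundamental_group X x0 \<theta>') (discrete_fundamental_group X x0 \<theta>)"
proof -
  have sub: "Z \<in> theta_loops_at \<theta> X x0" if "Z \<in> theta_loops_at \<theta>' X x0" for Z
    using that theta_path_mono[OF _ assms(2)] by (auto simp: theta_loops_at_def)
  have carr: "carrier (discrete_fundamental_group X x0 \<eta>) =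
      theta_class \<eta> X ` theta_loops_at \<eta> X x0" for \<eta>
    by (simp add: discrete_fundamental_group_def)
  show ?thesis
  proof (rule homI; unfold carr)
    fix A assume "A \<in> theta_class \<theta>' X ` theta_loops_at \<theta>' X x0"
    then show "scale_map X \<theta> A \<in> theta_class \<theta> X ` theta_loops_at \<theta> X x0"
      using sub assms(2) by (auto simp: scale_map_class)
  next
    fix A B
    assume "A \<in> theta_class \<theta>' X ` theta_loops_at \<theta>' X x0" "B \<in> theta_class \<theta>' X ` theta_loops_at \<theta>' X x0"
    then obtain Z W where ZW: "Z \<in> theta_loops_at \<theta>' X x0" "W \<in> theta_loops_at \<theta>' X x0"
      and eq: "A = theta_class \<theta>' X Z" "B = theta_class \<theta>' X W" by blast
    have "0 < \<theta>" using assms by simp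
    then show "scale_map X \<theta> (A \<otimes>\<^bsub>discrete_fundamental_group X x0 \<theta>'\<^esub> B) =
        scale_map X \<theta> A \<otimes>\<^bsub>discrete_fundamental_group X x0 \<theta>\<^esub> scale_map X \<theta> B"
      unfolding eq scale_map_class[OF assms(2)] discrete_fundamental_group_mult[OF ZW assms(1)]
      using discrete_fundamental_group_mult[OF sub[OF ZW(1)] sub[OF ZW(2)]] by simp
  qed
qed

theorem group_discrete_limit_group:
  assumes "x0 \<in> X"
  shows "group (discrete_limit_group X x0)"
proof -
  let ?G = "discrete_fundamental_group X x0"
  let ?P = "product_group {0<..} ?G"
  let ?C = "{c \<in> carrier ?P. \<forall>\<theta>' \<theta>. 0 < \<theta>' \<and> \<theta>' \<le> \<theta> \<longrightarrow> scale_map X \<theta> (c \<theta>') = c \<theta>}"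
  have G: "group (?G \<theta>)" if "\<theta> > 0" for \<theta>
    using group_discrete_fundamental_group[OF assms that] .
  then have P: "group ?P" by (intro product_group) auto
  have gh: "group_hom (?G \<theta>') (?G \<theta>) (scale_map X \<theta>)" if "0 < \<theta>'" "\<theta>' \<le> \<theta>" for \<theta>' \<theta>
    using that G scale_map_hom by (auto simp: group_hom_def group_hom_axioms_def)
  have "subgroup ?C ?P"
  proof (rule group.subgroupI[OF P])
    have "\<one>\<^bsub>?P\<^esub> \<in> ?C"
      using group.is_monoid[OF P, THEN monoid.one_closed] group_hom.hom_one[OF gh] by auto
    then show "?C \<noteq> {}" by blast
  next
    fix a assume a: "a \<in> ?C"
    then have "inv\<^bsub>?P\<^esub> a \<in> carrier ?P" using P by (blast intro: group.inv_closed)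
    moreover have inv: "inv\<^bsub>?P\<^esub> a = (\<lambda>\<theta>\<in>{0<..}. inv\<^bsub>?G \<theta>\<^esub> a \<theta>)"
      using a G by (intro inv_product_group) auto
    have "scale_map X \<theta> ((inv\<^bsub>?P\<^esub> a) \<theta>') = (inv\<^bsub>?P\<^esub> a) \<theta>" if t: "0 < \<theta>'" "\<theta>' \<le> \<theta>" for \<theta>' \<theta>
    proof -
      have "a \<theta>' \<in> carrier (?G \<theta>')" using a t by auto
      then show ?thesis using a t group_hom.hom_inv[OF gh[OF t]] by (auto simp: inv)
    qed
    ultimately show "inv\<^bsub>?P\<^esub> a \<in> ?C" by blast
  next
    fix a b assume ab: "a \<in> ?C" "b \<in> ?C"
    then have "a \<otimes>\<^bsub>?P\<^esub> b \<in> carrier ?P"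
      using P by (blast intro: monoid.m_closed group.is_monoid)
    moreover have "scale_map X \<theta> ((a \<otimes>\<^bsub>?P\<^esub> b) \<theta>') = (a \<otimes>\<^bsub>?P\<^esub> b) \<theta>" if t: "0 < \<theta>'" "\<theta>' \<le> \<theta>" for \<theta>' \<theta>
    proof -
      have "a \<theta>' \<in> carrier (?G \<theta>')" "b \<theta>' \<in> carrier (?G \<theta>')" using ab t by auto
      then have "scale_map X \<theta> (a \<theta>' \<otimes>\<^bsub>?G \<theta>'\<^esub> b \<theta>') = scale_map X \<theta> (a \<theta>') \<otimes>\<^bsub>?G \<theta>\<^esub> scale_map X \<theta> (b \<theta>')"
        by (rule hom_mult[OF scale_map_hom[OF t]])
      then show ?thesis using ab t by simp
    qed
    ultimately show "a \<otimes>\<^bsub>?P\<^esub> b \<in> ?C" by blast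
  qed auto
  then show ?thesis using subgroup.subgroup_is_group[OF _ P]
    by (simp add: discrete_limit_group_def Let_def)
qed

lemma homotopic_paths_const_left:
  assumes "path p" "path_image p \<subseteq> X"
  shows "homotopic_paths X ((\<lambda>_. pathstart p) +++ p) p"
proof -
  have "homotopic_paths X p ((\<lambda>_. pathstart p) +++ p)"
  proof (rule homotopic_paths_reparametrize[where f = "\<lambda>t. max 0 (2 * t - 1)"])
    show "((\<lambda>_. pathstart p) +++ p) t = p (max 0 (2 * t - 1))" if "t \<in> {0..1}" for t
    proof -
      have "max 0 (2 * t - 1) = (if t \<le> 1/2 then 0 else 2 * t - 1)" by auto
      then show ?thesis by (simp add: joinpaths_def pathstart_def)
    qed
  qed (use assms in \<open>auto intro!: continuous_intros\<close>)
  then show ?thesis by (rule homotopic_paths_sym)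
qed

lemma homotopic_paths_reverse_left:
  assumes "path p" "path_image p \<subseteq> X"
  shows "homotopic_paths X (reversepath p +++ p) (\<lambda>_. pathfinish p)"
proof -
  define f where "f = (\<lambda>z::real \<times> real. 1 - (1 - fst z) * (1 - \<bar>2 * snd z - 1\<bar>))"
  define h where "h = (\<lambda>z. p (f z))"
  have rng: "f z \<in> {0..1}" if "z \<in> {0..1} \<times> {0..1}" for z
  proof -
    have "0 \<le> 1 - fst z" "1 - fst z \<le> 1" "0 \<le> 1 - \<bar>2 * snd z - 1\<bar>" "1 - \<bar>2 * snd z - 1\<bar> \<le> 1"
      using that by (auto simp: abs_if mem_Times_iff)
    then have "0 \<le> (1 - fst z) * (1 - \<bar>2 * snd z - 1\<bar>)" "(1 - fst z) * (1 - \<bar>2 * snd z - 1\<bar>) \<le> 1"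
      by (simp_all add: mult_le_one)
    then show ?thesis by (simp add: f_def)
  qed
  have "continuous_on ({0..1} \<times> {0..1}) f"
    unfolding f_def by (intro continuous_intros)
  moreover have "continuous_on {0..1} p" using assms(1) by (simp add: path_def)
  ultimately have "continuous_on ({0..1} \<times> {0..1}) h"
    unfolding h_def using rng by (intro continuous_on_compose2[of "{0..1}" p _ f]) auto
  moreover have "h \<in> {0..1} \<times> {0..1} \<rightarrow> X"
    using assms(2) rng unfolding h_def path_image_def by blast
  moreover have "\<forall>t\<in>{0..1}. h (0, t) = (reversepath p +++ p) t"
  proof
    fix t :: real
    have "f (0, t) = (if t \<le> 1/2 then 1 - 2 * t else 2 * t - 1)" by (simp add: f_def abs_if)
    then show "h (0, t) = (reversepath p +++ p) t"
      by (simp add: h_def joinpaths_def reversepath_def)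
  qed
  moreover have "f (1, t) = 1" "f (s, 0) = 1" "f (s, 1) = 1" for s t by (simp_all add: f_def)
  ultimately show ?thesis unfolding homotopic_paths
    by (intro exI[of _ h]) (simp add: h_def pathstart_def pathfinish_def joinpaths_def reversepath_def)
qed

lemma homotopy_class_eq_iff:
  assumes "path p" "path_image p \<subseteq> X"
  shows "homotopy_class X p = homotopy_class X q \<longleftrightarrow> homotopic_paths X p q"
proof
  assume "homotopy_class X p = homotopy_class X q"
  moreover have "p \<in> homotopy_class X p" using assms by (simp add: homotopy_class_def)
  ultimately show "homotopic_paths X p q"
    by (simp add: homotopy_class_def homotopic_paths_sym)
next
  assume pq: "homotopic_paths X p q"
  have "homotopic_paths X p r \<longleftrightarrow> homotopic_paths X q r" for r
    using homotopic_paths_trans[OF pq] homotopic_paths_trans[OF homotopic_paths_sym[OF pq]] by blast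
  then show "homotopy_class X p = homotopy_class X q"
    by (simp add: homotopy_class_def)
qed

lemma loops_at_join:
  "p \<in> loops_at X x0 \<Longrightarrow> q \<in> loops_at X x0 \<Longrightarrow> p +++ q \<in> loops_at X x0"
  by (simp add: loops_at_def subset_path_image_join)

lemma fundamental_group_mult:
  assumes "p \<in> loops_at X x0" "q \<in> loops_at X x0"
  shows "homotopy_class X p \<otimes>\<^bsub>fundamental_group X x0\<^esub> homotopy_class X q = homotopy_class X (p +++ q)"
proof -
  have pq: "path (p +++ q)" "path_image (p +++ q) \<subseteq> X"
    using loops_at_join[OF assms] by (auto simp: loops_at_def)
  have "homotopy_class X (p' +++ q') = homotopy_class X (p +++ q)"
    if "p' \<in> homotopy_class X p" "q' \<in> homotopy_class X q" for p' q'
  proof -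
    have "homotopic_paths X (p +++ q) (p' +++ q')"
      using that assms by (intro homotopic_paths_join) (auto simp: homotopy_class_def loops_at_def)
    then show ?thesis using homotopy_class_eq_iff[OF pq] by metis
  qed
  moreover have "p \<in> homotopy_class X p" "q \<in> homotopy_class X q"
    using assms by (auto simp: homotopy_class_def loops_at_def)
  ultimately show ?thesis unfolding fundamental_group_def monoid.simps
    by (intro UN_constant_eq[of p] UN_constant_eq[of q] ballI)
qed

theorem group_fundamental_group:
  assumes "x0 \<in> X"
  shows "group (fundamental_group X x0)" (is "group ?G")
proof -
  let ?L = "loops_at X x0"
  have carr: "carrier ?G = homotopy_class X ` ?L" and one: "\<one>\<^bsub>?G\<^esub> = homotopy_class X (\<lambda>_. x0)"
    by (simp_all add: fundamental_group_def)
  have const: "(\<lambda>_. x0) \<in> ?L"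
    using assms by (auto simp: loops_at_def path_def path_image_def pathstart_def pathfinish_def)
  have eq: "homotopy_class X p = homotopy_class X q" if "homotopic_paths X p q" for p q
    using that homotopy_class_eq_iff[of p X q] homotopic_paths_imp_path[OF that]
      homotopic_paths_imp_subset[OF that] by simp
  note mult = fundamental_group_mult and join = loops_at_join
  show ?thesis
  proof (rule groupI; unfold carr one)
    fix A B assume "A \<in> homotopy_class X ` ?L" "B \<in> homotopy_class X ` ?L"
    then show "A \<otimes>\<^bsub>?G\<^esub> B \<in> homotopy_class X ` ?L" by (auto simp: mult join)
  next
    fix A B C
    assume "A \<in> homotopy_class X ` ?L" "B \<in> homotopy_class X ` ?L" "C \<in> homotopy_class X ` ?L"
    then obtain p q r where pqr: "p \<in> ?L" "q \<in> ?L" "r \<in> ?L"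
      "A = homotopy_class X p" "B = homotopy_class X q" "C = homotopy_class X r" by auto
    have "homotopic_paths X ((p +++ q) +++ r) (p +++ (q +++ r))"
      using pqr(1-3) by (intro homotopic_paths_sym[OF homotopic_paths_assoc]) (auto simp: loops_at_def)
    then show "A \<otimes>\<^bsub>?G\<^esub> B \<otimes>\<^bsub>?G\<^esub> C = A \<otimes>\<^bsub>?G\<^esub> (B \<otimes>\<^bsub>?G\<^esub> C)"
      using pqr by (simp add: mult join eq)
  next
    fix A assume "A \<in> homotopy_class X ` ?L"
    then obtain p where p: "p \<in> ?L" "A = homotopy_class X p" by auto
    have "homotopic_paths X ((\<lambda>_. x0) +++ p) p"
      using p(1) homotopic_paths_const_left[of p X] by (simp add: loops_at_def)
    then show "homotopy_class X (\<lambda>_. x0) \<otimes>\<^bsub>?G\<^esub> A = A" using mult[OF const p(1)] p eq by simp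
    have R: "reversepath p \<in> ?L" using p(1) by (simp add: loops_at_def)
    have "homotopic_paths X (reversepath p +++ p) (\<lambda>_. x0)"
      using p(1) homotopic_paths_reverse_left[of p X] by (simp add: loops_at_def)
    then show "\<exists>B\<in>homotopy_class X ` ?L. B \<otimes>\<^bsub>?G\<^esub> A = homotopy_class X (\<lambda>_. x0)"
      using mult[OF R p(1)] R p eq by (intro bexI[of _ "homotopy_class X (reversepath p)"]) simp_all
  qed (use const in auto)
qed

end

(*
  Fix a scale at which close points are joined by short paths and short loops are null-homotopic.
  A theta-path at a small scale is then traced by a continuous path of which it is a discretisation,
  so the inverse of the discretisation homomorphism is "trace". It is well defined because
  two paths tracing pointwise close theta-paths are homotopic: join corresponding points by short
  rungs, and every square of the resulting ladder lies in a small ball. A grid homotopy is a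
  finite sequence of such ladders, and a lazification is traced by the same path. For surjectivity,
  a compatible family is traced at one scale only; tracing it at a finer scale gives a homotopic
  path, whose discretisations give the family at every scale.
*)

theory Submission
  imports Defs
begin

text \<open>Two scales are kept apart: \<open>\<eta>\<close> bounds the jumps of a discrete path,
  while \<open>r\<close> bounds the balls in which the continuous pieces between its points run.
  Concatenation of paths is associative only up to homotopy, so "traces" is a relation on lists that
  absorbs homotopies at every step, not a fixed parametrisation; a list then determines its tracing
  path up to homotopy, and any convenient representative may be chosen. That the map is well defined
  on homotopy classes needs an argument of its own. A grid homotopy compares lists of equal length,
  whereas discretisations of two homotopic loops have unrelated lengths and times, so both are first
  refined to a common length. One-point lists are a recurring special case: a discretisation uses
  both times 0 and 1 and hence has at least two entries, although the constant discrete loop has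
  one.\<close>

section \<open>Grid homotopies from bounds on neighbouring grid points\<close>

lemma dist_chain_le:
  fixes f :: "nat \<Rightarrow> 'a::metric_space"
  assumes "\<And>i. a \<le> i \<Longrightarrow> i < b \<Longrightarrow> dist (f i) (f (Suc i)) \<le> \<theta>" "a \<le> b"
  shows "dist (f a) (f b) \<le> \<theta> * (real b - real a)"
  using assms(2,1)
proof (induction rule: dec_induct)
  case (step n)
  have "dist (f a) (f (Suc n)) \<le> dist (f a) (f n) + dist (f n) (f (Suc n))"
    by (rule dist_triangle)
  also have "dist (f a) (f n) \<le> \<theta> * (real n - real a)" using step by simp
  also have "dist (f n) (f (Suc n)) \<le> \<theta>" using step by simp
  finally show ?case by (simp add: algebra_simps)
qed simp

lemma dist_chain_le_abs:
  fixes f :: "nat \<Rightarrow> 'a::metric_space"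
  assumes "\<And>i. i < n \<Longrightarrow> dist (f i) (f (Suc i)) \<le> \<theta>" "a \<le> n" "b \<le> n"
  shows "dist (f a) (f b) \<le> \<theta> * \<bar>real a - real b\<bar>"
proof (cases "a \<le> b")
  case True
  then show ?thesis using dist_chain_le[of a b f \<theta>] assms by simp
next
  case False
  then show ?thesis using dist_chain_le[of b a f \<theta>] assms by (simp add: dist_commute)
qed

text \<open>The l1 metric on the grid is measured along a row followed by a column, so the Lipschitz
  bound follows by adding the bounds for adjacent points.\<close>

lemma theta_grid_homotopyI:
  assumes len: "length Z = Suc n" "length W = Suc n"
    and X: "\<And>i t. i \<le> n \<Longrightarrow> t \<le> m \<Longrightarrow> H i t \<in> X"
    and row: "\<And>i t. i < n \<Longrightarrow> t \<le> m \<Longrightarrow> dist (H i t) (H (Suc i) t) \<le> \<theta>"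
    and col: "\<And>i t. i \<le> n \<Longrightarrow> t < m \<Longrightarrow> dist (H i t) (H i (Suc t)) \<le> \<theta>"
    and bot: "\<And>i. i \<le> n \<Longrightarrow> H i 0 = Z ! i" and top: "\<And>i. i \<le> n \<Longrightarrow> H i m = W ! i"
    and ends: "\<And>t. t \<le> m \<Longrightarrow> H 0 t = Z ! 0" "\<And>t. t \<le> m \<Longrightarrow> H n t = Z ! n"
  shows "theta_grid_homotopy \<theta> X Z W m H"
  unfolding theta_grid_homotopy_def
proof (intro exI[of _ n] conjI allI impI)
  fix i i' t t' assume b: "i \<le> n" "i' \<le> n" "t \<le> m" "t' \<le> m"
  have "dist (H i t) (H i' t') \<le> dist (H i t) (H i' t) + dist (H i' t) (H i' t')"
    by (rule dist_triangle)
  also have "dist (H i t) (H i' t) \<le> \<theta> * \<bar>real i - real i'\<bar>"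
    using dist_chain_le_abs[of n "\<lambda>i. H i t" \<theta>] row b by blast
  also have "dist (H i' t) (H i' t') \<le> \<theta> * \<bar>real t - real t'\<bar>"
    using dist_chain_le_abs[of m "H i'" \<theta>] col b by blast
  finally show "dist (H i t) (H i' t') \<le> \<theta> * (\<bar>real i - real i'\<bar> + \<bar>real t - real t'\<bar>)"
    by (simp add: algebra_simps)
next
  fix t assume "t \<le> m"
  then show "H 0 t = W ! 0" "H n t = W ! n"
    using ends(1)[of t] ends(1)[of m] top[of 0] ends(2)[of t] ends(2)[of m] top[of n] by simp_all
qed (use len X bot top ends in auto)

lemma theta_homotopic_gridI:
  assumes len: "length Z = Suc n" "length W = Suc n"
    and X: "\<And>i t. i \<le> n \<Longrightarrow> t \<le> m \<Longrightarrow> H i t \<in> X"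
    and row: "\<And>i t. i < n \<Longrightarrow> t \<le> m \<Longrightarrow> dist (H i t) (H (Suc i) t) \<le> \<theta>"
    and col: "\<And>i t. i \<le> n \<Longrightarrow> t < m \<Longrightarrow> dist (H i t) (H i (Suc t)) \<le> \<theta>"
    and bot: "\<And>i. i \<le> n \<Longrightarrow> H i 0 = Z ! i" and top: "\<And>i. i \<le> n \<Longrightarrow> H i m = W ! i"
    and ends: "\<And>t. t \<le> m \<Longrightarrow> H 0 t = Z ! 0" "\<And>t. t \<le> m \<Longrightarrow> H n t = Z ! n"
  shows "theta_homotopic \<theta> X Z W"
proof -
  have "theta_path \<theta> X V"
    if V: "length V = Suc n" "\<And>i. i \<le> n \<Longrightarrow> V ! i = H i t" and t: "t \<le> m" for V t
    unfolding theta_path_def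
  proof (intro conjI allI impI)
    show "V \<noteq> []" using V(1) by auto
    show "set V \<subseteq> X" using V X t by (auto simp: in_set_conv_nth less_Suc_eq_le)
    show "dist (V ! i) (V ! Suc i) \<le> \<theta>" if "Suc i < length V" for i
      using that V row t by simp
  qed
  from this[of Z 0] this[of W m] have "theta_path \<theta> X Z" "theta_path \<theta> X W"
    using len bot top by auto
  then show ?thesis
    using theta_grid_homotopyI[of Z n W m H X \<theta>] assms
    by (intro theta_homotopic_step) (auto simp: theta_step_def)
qed

text \<open>The two lists are the rows of a grid of height 1, and pointwise closeness bounds its
  columns.\<close>

lemma theta_homotopic_closeI:
  assumes "theta_path \<theta> X Z" "theta_path \<theta> X W" "length Z = length W"
    and "hd Z = hd W" "last Z = last W"
    and "\<And>i. i < length Z \<Longrightarrow> dist (Z ! i) (W ! i) \<le> \<theta>"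
  shows "theta_homotopic \<theta> X Z W"
proof -
  obtain n where n: "length Z = Suc n" using assms(1) by (cases Z) (auto simp: theta_path_def)
  then have nW: "length W = Suc n" using assms(3) by simp
  have ne: "Z \<noteq> []" "W \<noteq> []" using n nW by auto
  have "Z ! 0 = W ! 0" "Z ! n = W ! n"
    using assms(4,5) by (simp_all add: hd_conv_nth[OF ne(1)] hd_conv_nth[OF ne(2)]
        last_conv_nth[OF ne(1)] last_conv_nth[OF ne(2)] n nW)
  then show ?thesis
    using assms(1-3,6) n
    by (intro theta_homotopic_gridI[where n = n and m = 1 and H = "\<lambda>i t. if t = 0 then Z ! i else W ! i"])
      (auto simp: theta_path_def subset_iff)
qed

section \<open>Discretisations and the times that produce them\<close>

text \<open>
  Closed intervals, unlike in \<^const>\<open>theta_discretisation\<close>: by continuity this makes no difference.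
\<close>

definition fine_times :: "real \<Rightarrow> (real \<Rightarrow> 'a::metric_space) \<Rightarrow> real list \<Rightarrow> bool" where
  "fine_times \<theta> g ts \<longleftrightarrow> ts \<noteq> [] \<and> sorted ts \<and> set ts \<subseteq> {0..1} \<and>
     (\<forall>i. Suc i < length ts \<longrightarrow> g ` {ts ! i..ts ! Suc i} \<subseteq> cball (g (ts ! i)) \<theta>)"

lemma fine_times_nth:
  assumes "fine_times \<theta> g ts" "Suc i < length ts"
  shows "ts ! i \<in> {0..1}" "ts ! Suc i \<in> {0..1}" "ts ! i \<le> ts ! Suc i"
    "g ` {ts ! i..ts ! Suc i} \<subseteq> cball (g (ts ! i)) \<theta>"
  using assms unfolding fine_times_def
  by (simp_all add: subset_iff Suc_lessD sorted_wrt_nth_less)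

lemma theta_discretisation_iff_fine_times:
  assumes g: "path g" and "0 \<le> \<theta>"
  shows "theta_discretisation \<theta> g Z \<longleftrightarrow>
    (\<exists>ts. fine_times \<theta> g ts \<and> hd ts = 0 \<and> last ts = 1 \<and> Z = map g ts)"
proof -
  have "(\<forall>i. Suc i < length ts \<longrightarrow> g ` {ts ! i<..<ts ! Suc i} \<subseteq> cball (g (ts ! i)) \<theta>)
      \<longleftrightarrow> fine_times \<theta> g ts"
    if ts: "ts \<noteq> []" "hd ts = 0" "last ts = 1" "sorted ts" for ts
  proof -
    have 01: "set ts \<subseteq> {0..1}"
    proof
      fix t assume "t \<in> set ts"
      then obtain i where i: "i < length ts" "t = ts ! i" by (auto simp: in_set_conv_nth)
      have "ts ! 0 \<le> ts ! i" "ts ! i \<le> ts ! (length ts - 1)"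
        using ts(4) i by (auto intro!: sorted_nth_mono)
      then show "t \<in> {0..1}"
        using ts(1-3) i by (simp add: hd_conv_nth last_conv_nth)
    qed
    have "g ` {ts ! i..ts ! Suc i} \<subseteq> cball (g (ts ! i)) \<theta>"
      if i: "Suc i < length ts" and *: "g ` {ts ! i<..<ts ! Suc i} \<subseteq> cball (g (ts ! i)) \<theta>" for i
    proof (cases "ts ! i = ts ! Suc i")
      case True
      then show ?thesis using \<open>0 \<le> \<theta>\<close> by simp
    next
      case False
      have le: "ts ! i \<le> ts ! Suc i" using ts(4) i by (simp add: sorted_nth_mono)
      have "ts ! i \<in> {0..1}" "ts ! Suc i \<in> {0..1}" using 01 i by (auto simp: subset_iff)
      then have "continuous_on {ts ! i..ts ! Suc i} g"
        using g unfolding path_def by (auto intro: continuous_on_subset)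
      \<comment> \<open>The target ball is closed, so continuity carries the bound to the closure of
        the open interval. For equal times that interval is empty and its closure lacks the
        endpoint, hence the case split.\<close>
      then have "g ` closure {ts ! i<..<ts ! Suc i} \<subseteq> cball (g (ts ! i)) \<theta>"
        using * False le by (intro image_closure_subset) auto
      then show ?thesis using False le by simp
    qed
    moreover have "g ` {ts ! i<..<ts ! Suc i} \<subseteq> g ` {ts ! i..ts ! Suc i}" for i
      by (intro image_mono) auto
    ultimately show ?thesis using ts 01 unfolding fine_times_def by (meson order_trans)
  qed
  then show ?thesis
    unfolding theta_discretisation_def by (metis fine_times_def)
qed

lemma theta_path_map_fine_times:
  assumes "fine_times \<theta> g ts" "path_image g \<subseteq> X"
  shows "theta_path \<theta> X (map g ts)"
  unfolding theta_path_def
proof (intro conjI allI impI)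
  show "map g ts \<noteq> []" "set (map g ts) \<subseteq> X"
    using assms by (auto simp: fine_times_def path_image_def)
  fix i assume "Suc i < length (map g ts)"
  then show "dist (map g ts ! i) (map g ts ! Suc i) \<le> \<theta>"
    using fine_times_nth[OF assms(1), of i] by (auto simp: image_subset_iff)
qed

lemma theta_discretisation_theta_path:
  assumes "path g" "path_image g \<subseteq> X" "0 \<le> \<theta>" "theta_discretisation \<theta> g Z"
  shows "theta_path \<theta> X Z" "hd Z = pathstart g" "last Z = pathfinish g"
proof -
  obtain ts where ts: "fine_times \<theta> g ts" "hd ts = 0" "last ts = 1" "Z = map g ts"
    using assms by (auto simp: theta_discretisation_iff_fine_times)
  then have "ts \<noteq> []" by (auto simp: fine_times_def)
  then show "theta_path \<theta> X Z" "hd Z = pathstart g" "last Z = pathfinish g"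
    using ts theta_path_map_fine_times assms
    by (auto simp: pathstart_def pathfinish_def hd_map last_map)
qed

lemma theta_discretisation_mono:
  assumes "theta_discretisation \<theta>' g Z" "\<theta>' \<le> \<theta>"
  shows "theta_discretisation \<theta> g Z"
proof -
  have "cball x \<theta>' \<subseteq> cball x \<theta>" for x :: 'a using assms(2) by (rule subset_cball)
  then show ?thesis using assms(1) unfolding theta_discretisation_def by (metis subset_trans)
qed

lemma ex_theta_discretisation:
  assumes "path g" "0 < \<theta>"
  shows "\<exists>Z. theta_discretisation \<theta> g Z"
proof -
  have "uniformly_continuous_on {0..1} g"
    using assms(1) by (auto simp: path_def intro: compact_uniformly_continuous)
  then obtain d where d: "d > 0"
    "\<And>s t. s \<in> {0..1} \<Longrightarrow> t \<in> {0..1} \<Longrightarrow> dist s t < d \<Longrightarrow> dist (g s) (g t) < \<theta>"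
    unfolding uniformly_continuous_on_def using assms(2) by (metis dist_commute)
  obtain N where N: "1 / real (Suc N) < d" using reals_Archimedean[OF d(1)] by (auto simp: inverse_eq_divide)
  define ts where "ts = map (\<lambda>i. real i / real (Suc N)) [0..<Suc (Suc N)]"
  have nth: "ts ! i = real i / real (Suc N)" if "i \<le> Suc N" for i
    using that unfolding ts_def by (subst nth_map) (auto simp del: upt_Suc)
  have len: "length ts = Suc (Suc N)" by (simp add: ts_def)
  then have ne: "ts \<noteq> []" by auto
  have 01: "ts ! i \<in> {0..1}" if "i \<le> Suc N" for i using that nth[OF that] by auto
  have "fine_times \<theta> g ts" unfolding fine_times_def
  proof (intro conjI allI impI)
    show "sorted ts" unfolding sorted_iff_nth_mono using nth len by (auto intro!: divide_right_mono)
    show "set ts \<subseteq> {0..1}" using 01 len by (auto simp: set_conv_nth)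
    fix i assume i: "Suc i < length ts"
    show "g ` {ts ! i..ts ! Suc i} \<subseteq> cball (g (ts ! i)) \<theta>"
    proof clarify
      fix s assume s: "s \<in> {ts ! i..ts ! Suc i}"
      have "ts ! Suc i - ts ! i = 1 / real (Suc N)" using i len nth by (simp add: field_simps)
      then have "dist (ts ! i) s < d" using s N by (simp add: dist_real_def)
      moreover have "s \<in> {0..1}" using s 01[of i] 01[of "Suc i"] i len by auto
      ultimately show "g s \<in> cball (g (ts ! i)) \<theta>"
        using d(2)[of "ts ! i" s] 01[of i] i len by force
    qed
  qed (rule ne)
  moreover have "hd ts = 0" "last ts = 1"
    using ne len nth by (simp_all add: hd_conv_nth last_conv_nth)
  ultimately show ?thesis
    using assms theta_discretisation_iff_fine_times by (metis less_eq_real_def)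
qed

section \<open>Homotopic paths have homotopic discretisations\<close>

text \<open>
  Every interval \<open>[t i, t (i + 1)]\<close> is split into the same number \<open>M\<close> of parts, however short it is, so
  that the original points are repeated along \<open>k \<mapsto> k div M\<close> and a lazification compares the two.
\<close>

definition refine_times :: "(nat \<Rightarrow> real) \<Rightarrow> nat \<Rightarrow> nat \<Rightarrow> real" where
  "refine_times t M k = t (k div M) + (t (Suc (k div M)) - t (k div M)) * (real (k mod M) / real M)"

text \<open>At the last part of an interval the index rolls over to remainder 0 of the next one,
  which is the same time as the right end of the present interval. The increment formula therefore
  also holds across the original times.\<close>

lemma refine_times_Suc:
  assumes "M > 0"
  shows "refine_times t M (Suc k) - refine_times t M k = (t (Suc (k div M)) - t (k div M)) / real M"
proof (cases "Suc (k mod M) = M")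
  case True
  then have "real (k mod M) = real M - 1" by linarith
  then have r: "real (k mod M) / real M = 1 - 1 / real M" using assms by (simp add: diff_divide_distrib)
  have "Suc k div M = Suc (k div M)" "Suc k mod M = 0" using True by (simp_all add: mod_Suc div_Suc)
  then show ?thesis unfolding refine_times_def r by (simp add: algebra_simps diff_divide_distrib)
next
  case False
  then show ?thesis using assms
    by (simp add: refine_times_def mod_Suc div_Suc divide_simps algebra_simps)
qed

lemma refine_times_mem:
  assumes "M > 0" "t (k div M) \<le> t (Suc (k div M))"
  shows "refine_times t M k \<in> {t (k div M)..t (Suc (k div M))}"
proof -
  let ?d = "t (Suc (k div M)) - t (k div M)" and ?r = "real (k mod M) / real M"
  have r: "0 \<le> ?r" "?r \<le> 1" using assms(1) by (simp_all add: divide_simps less_imp_le)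
  then have "0 \<le> ?d * ?r" "?d * ?r \<le> ?d" using assms(2) mult_left_le[of ?r ?d] mult_nonneg_nonneg[of ?d ?r] by linarith+
  then show ?thesis by (simp add: refine_times_def)
qed

lemma refine_times_mult [simp]: "M > 0 \<Longrightarrow> refine_times t M (n * M) = t n"
  by (simp add: refine_times_def)

text \<open>Passes through the list \<open>V\<close> that repeats each point of \<open>Z\<close>:
  \<open>V\<close> is a lazification of \<open>Z\<close>, and each entry of the refined list lies in
  the cell of the corresponding entry of \<open>V\<close>. The truncation \<open>min i n\<close>
  extends \<open>t\<close> constantly, since at the last index \<open>n * M\<close> the definition
  of \<open>refine_times\<close> also reads \<open>t (Suc n)\<close>.\<close>

lemma theta_homotopic_refine_times:
  assumes ts: "fine_times \<theta> g ts" and X: "path_image g \<subseteq> X" and "0 \<le> \<theta>"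
    and len: "length ts = Suc n" "0 < n" and M: "2 \<le> M" and t: "\<And>i. t i = ts ! min i n"
    and step: "\<And>k. dist (g (refine_times t M k)) (g (refine_times t M (Suc k))) \<le> \<theta>"
  shows "theta_homotopic \<theta> X (map g ts) (map (g \<circ> refine_times t M) [0..<Suc (n * M)])"
proof -
  define Z where "Z = map g ts"
  define V where "V = map (\<lambda>k. Z ! (k div M)) [0..<Suc (n * M)]"
  define W where "W = map (g \<circ> refine_times t M) [0..<Suc (n * M)]"
  have M0: "M > 0" using M by simp
  have t01: "t i \<in> {0..1}" for i
    using ts len by (simp add: fine_times_def t subset_iff)
  have t_mono: "t i \<le> t j" if "i \<le> j" for i j
    using ts that len by (auto simp: fine_times_def t intro!: sorted_nth_mono)
  have cell: "g ` {t i..t (Suc i)} \<subseteq> cball (g (t i)) \<theta>" for i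
    using fine_times_nth(4)[OF ts, of i] len \<open>0 \<le> \<theta>\<close> by (cases "i < n") (simp_all add: t)
  have r01: "refine_times t M k \<in> {0..1}" for k
    using refine_times_mem[where t = t and M = M and k = k] t01[of "k div M"] t01[of "Suc (k div M)"] M0 t_mono[of "k div M" "Suc (k div M)"]
    by auto
  have nZ: "length Z = Suc n" by (simp add: Z_def len)
  have Zt: "Z ! i = g (t i)" if "i \<le> n" for i using that len by (simp add: Z_def t)
  have nthV: "V ! k = Z ! (k div M)" and nthW: "W ! k = g (refine_times t M k)" if "k \<le> n * M" for k
    unfolding V_def W_def using that by (subst nth_map; simp add: less_Suc_eq_le del: upt_Suc)+
  have lenV: "length V = Suc (n * M)" "length W = Suc (n * M)" by (simp_all add: V_def W_def)
  have div_le: "k div M \<le> n" if "k \<le> n * M" for k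
    using that M0 div_le_mono[OF that, of M] by simp
  have Zp: "theta_path \<theta> X Z" unfolding Z_def using ts X by (rule theta_path_map_fine_times)
  \<comment> \<open>A lazification must be strictly longer; this is where \<open>0 < n\<close> and
    \<open>2 \<le> M\<close> enter.\<close>
  have "n * 1 < n * M" using len(2) M by (intro mult_strict_left_mono) auto
  then have lt: "length Z < length V" using nZ lenV by simp
  have "(\<lambda>k. k div M) ` {..<length V} = {..<length Z}"
  proof (intro equalityI subsetI)
    fix i assume "i \<in> {..<length Z}"
    then show "i \<in> (\<lambda>k. k div M) ` {..<length V}"
      using M0 nZ lenV by (intro image_eqI[of _ _ "i * M"]) (auto simp: less_Suc_eq_le)
  qed (use div_le nZ lenV in \<open>auto simp: less_Suc_eq_le\<close>)
  then have laz: "lazification Z V"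
    unfolding lazification_def using lt nthV lenV
    by (intro conjI exI[of _ "\<lambda>k. k div M"]) (auto intro!: mono_onI div_le_mono)
  have Vp: "theta_path \<theta> X V"
    unfolding theta_path_def
  proof (intro conjI allI impI)
    show "V \<noteq> []" using lenV by auto
    show "set V \<subseteq> X"
      using Zp nthV lenV div_le nZ by (auto simp: set_conv_nth theta_path_def less_Suc_eq_le)
    fix k assume k: "Suc k < length V"
    then have "V ! k = Z ! (k div M)" "V ! Suc k = Z ! (Suc k div M)" "Suc k div M \<le> n"
      using nthV lenV div_le by auto
    then show "dist (V ! k) (V ! Suc k) \<le> \<theta>"
      using Zp nZ \<open>0 \<le> \<theta>\<close> by (auto simp: div_Suc theta_path_def)
  qed
  have Wp: "theta_path \<theta> X W"
    unfolding theta_path_def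
  proof (intro conjI allI impI)
    show "W \<noteq> []" using lenV by auto
    show "set W \<subseteq> X" using X r01 by (auto simp: W_def path_image_def)
    fix k assume k: "Suc k < length W"
    then show "dist (W ! k) (W ! Suc k) \<le> \<theta>" using step[of k] nthW[of k] nthW[of "Suc k"] lenV by simp
  qed
  have "theta_homotopic \<theta> X V W"
  proof (rule theta_homotopic_closeI[OF Vp Wp])
    have ne: "V \<noteq> []" "W \<noteq> []" using lenV by auto
    show "hd V = hd W"
      using nthV[of 0] nthW[of 0] Zt[of 0] refine_times_mult[of M t 0] M0 ne by (simp add: hd_conv_nth)
    show "last V = last W"
      using nthV[of "n * M"] nthW[of "n * M"] Zt[of n] M0 ne by (simp add: last_conv_nth lenV)
    fix k assume "k < length V"
    then have k: "k \<le> n * M" using lenV by simp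
    then have V: "V ! k = g (t (k div M))" using nthV Zt div_le by simp
    have "refine_times t M k \<in> {t (k div M)..t (Suc (k div M))}"
      using M0 t_mono by (intro refine_times_mem) auto
    then show "dist (V ! k) (W ! k) \<le> \<theta>"
      using cell[of "k div M"] unfolding V nthW[OF k] by (auto simp: image_subset_iff)
  qed (simp add: lenV)
  moreover have "theta_homotopic \<theta> X Z V"
    using laz Zp Vp by (intro theta_homotopic_step) (auto simp: theta_step_def)
  ultimately show ?thesis unfolding Z_def W_def by (metis theta_homotopic_trans)
qed

text \<open>
  Refining the two discretisations to a common number of times and interpolating between the times
  while the homotopy runs gives a grid homotopy.
\<close>

lemma theta_homotopic_of_homotopic_paths:
  assumes pq: "homotopic_paths X p q" and "0 < \<theta>"
    and Z: "theta_discretisation \<theta> p Z" and W: "theta_discretisation \<theta> q W"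
  shows "theta_homotopic \<theta> X Z W"
proof -
  have p: "path p" "path_image p \<subseteq> X" and q: "path q" "path_image q \<subseteq> X"
    using homotopic_paths_imp_path[OF pq] homotopic_paths_imp_subset[OF pq] by auto
  obtain ts where ts: "fine_times \<theta> p ts" "hd ts = 0" "last ts = 1" "Z = map p ts"
    using Z p assms(2) by (auto simp: theta_discretisation_iff_fine_times)
  obtain us where us: "fine_times \<theta> q us" "hd us = 0" "last us = 1" "W = map q us"
    using W q assms(2) by (auto simp: theta_discretisation_iff_fine_times)
  obtain n where n: "length ts = Suc n" "0 < n"
    using ts(1-3) by (cases ts; cases "tl ts") (auto simp: fine_times_def)
  obtain n' where n': "length us = Suc n'" "0 < n'"
    using us(1-3) by (cases us; cases "tl us") (auto simp: fine_times_def)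
  obtain h :: "real \<times> real \<Rightarrow> 'a" where hc: "continuous_on ({0..1} \<times> {0..1}) h" "h \<in> {0..1} \<times> {0..1} \<rightarrow> X"
    and hb: "\<forall>x\<in>{0..1}. h (0, x) = p x" "\<forall>x\<in>{0..1}. h (1, x) = q x"
      "\<forall>s\<in>{0..1}. h (s, 0) = p 0 \<and> h (s, 1) = p 1"
    using pq unfolding homotopic_paths pathstart_def pathfinish_def o_apply by blast
  have h: "h (0, x) = p x" "h (1, x) = q x" "h (x, 0) = p 0" "h (x, 1) = p 1" if "x \<in> {0..1}" for x
    using hb that by auto
  have "uniformly_continuous_on ({0..1} \<times> {0..1}) h"
    using hc(1) by (intro compact_uniformly_continuous compact_Times) auto
  then obtain d where d: "d > 0"
    "\<And>z w. z \<in> {0..1} \<times> {0..1} \<Longrightarrow> w \<in> {0..1} \<times> {0..1} \<Longrightarrow> dist z w < d \<Longrightarrow> dist (h z) (h w) < \<theta>"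
    unfolding uniformly_continuous_on_def using assms(2) by (metis dist_commute)
  \<comment> \<open>The product distance is at most the sum of the coordinate distances, so
    \<open>d / 2\<close> in each coordinate suffices.\<close>
  have hd: "dist (h (s, a)) (h (s', a')) \<le> \<theta>"
    if "s \<in> {0..1}" "a \<in> {0..1}" "s' \<in> {0..1}" "a' \<in> {0..1}" "\<bar>s - s'\<bar> < d / 2" "\<bar>a - a'\<bar> < d / 2"
    for s a s' a'
  proof -
    have "dist (s, a) (s', a') \<le> dist s s' + dist a a'"
      unfolding dist_prod_def by (simp add: sqrt_sum_squares_le_sum)
    then have "dist (s, a) (s', a') < d" using that(5,6) by (simp add: dist_real_def)
    then show ?thesis using d(2)[of "(s, a)" "(s', a')"] that by auto
  qed
  obtain M0 where M0: "1 / real (Suc M0) < d / 2"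
    using reals_Archimedean[of "d / 2"] d(1) by (auto simp: inverse_eq_divide)
  \<comment> \<open>One \<open>M\<close> serves three purposes: at least 2 for the lazifications,
    and \<open>1 / M < d / 2\<close> both for the time steps and for the steps of the homotopy
    parameter.\<close>
  define M where "M = Suc (Suc M0)"
  have M: "2 \<le> M" by (simp add: M_def)
  have "1 / real M \<le> 1 / real (Suc M0)" by (simp add: M_def divide_simps)
  then have Md: "1 / real M < d / 2" using M0 by linarith
  define t where "t i = ts ! min i n" for i
  define u where "u i = us ! min i n'" for i
  \<comment> \<open>The \<open>n\<close> intervals of \<open>ts\<close> are cut into
    \<open>n' * M\<close> parts and the \<open>n'\<close> intervals of \<open>us\<close> into
    \<open>n * M\<close> parts, so both refinements have \<open>L\<close> intervals.\<close>
  define \<tau> where "\<tau> = refine_times t (n' * M)"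
  define \<sigma> where "\<sigma> = refine_times u (n * M)"
  define L where "L = n * (n' * M)"
  have refined: "f k \<in> {0..1} \<and> \<bar>f k - f (Suc k)\<bar> < d / 2"
    if "fine_times \<theta> g vs" "length vs = Suc j" "f = refine_times (\<lambda>i. vs ! min i j) (l * M)" "0 < l"
    for g :: "real \<Rightarrow> 'a" and vs f j l k
  proof -
    let ?v = "\<lambda>i. vs ! min i j"
    have 01: "?v i \<in> {0..1}" for i
      using that(1,2) by (simp add: fine_times_def subset_iff)
    have mono: "?v i \<le> ?v (Suc i)" for i
      using that(1,2) by (auto simp: fine_times_def intro!: sorted_nth_mono)
    have lM: "l * M > 0" "M \<le> l * M" using that(4) M by simp_all
    let ?k = "k div (l * M)"
    have k01: "?v ?k \<in> {0..1}" "?v (Suc ?k) \<in> {0..1}" by (rule 01)+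
    have "f k \<in> {?v ?k..?v (Suc ?k)}"
      unfolding that(3) using lM(1) mono by (intro refine_times_mem)
    then have "f k \<in> {0..1}" using k01 by auto
    moreover
    define D where "D = (?v (Suc ?k) - ?v ?k) / real (l * M)"
    have "f (Suc k) - f k = D"
      unfolding that(3) D_def by (rule refine_times_Suc[OF lM(1)])
    moreover have "0 \<le> D" using mono by (simp add: D_def)
    moreover have "D \<le> 1 / real M"
      unfolding D_def using k01 mono[of ?k] lM M by (intro frac_le) (auto simp del: of_nat_mult)
    ultimately show ?thesis using Md by simp
  qed
  have \<tau>: "\<tau> k \<in> {0..1}" "\<bar>\<tau> k - \<tau> (Suc k)\<bar> < d / 2" for k
    using refined[OF ts(1) n(1) _ n'(2), of \<tau> k] by (simp_all add: \<tau>_def t_def[abs_def])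
  have \<sigma>: "\<sigma> k \<in> {0..1}" "\<bar>\<sigma> k - \<sigma> (Suc k)\<bar> < d / 2" for k
    using refined[OF us(1) n'(1) _ n(2), of \<sigma> k] by (simp_all add: \<sigma>_def u_def[abs_def])
  have d2: "0 < d / 2" using d(1) by simp
  have "theta_homotopic \<theta> X Z (map (p \<circ> \<tau>) [0..<Suc (n * (n' * M))])"
    unfolding ts(4) \<tau>_def
  proof (rule theta_homotopic_refine_times[OF ts(1) p(2) _ n])
    show "2 \<le> n' * M" using n'(2) M by (cases n') auto
    show "dist (p (refine_times t (n' * M) k)) (p (refine_times t (n' * M) (Suc k))) \<le> \<theta>" for k
      using hd[of 0 "\<tau> k" 0 "\<tau> (Suc k)"] \<tau>[of k] \<tau>(1)[of "Suc k"] h(1) d2 by (simp add: \<tau>_def)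
  qed (use assms(2) in \<open>auto simp: t_def\<close>)
  moreover have "theta_homotopic \<theta> X W (map (q \<circ> \<sigma>) [0..<Suc (n' * (n * M))])"
    unfolding us(4) \<sigma>_def
  proof (rule theta_homotopic_refine_times[OF us(1) q(2) _ n'])
    show "2 \<le> n * M" using n(2) M by (cases n) auto
    show "dist (q (refine_times u (n * M) k)) (q (refine_times u (n * M) (Suc k))) \<le> \<theta>" for k
      using hd[of 1 "\<sigma> k" 1 "\<sigma> (Suc k)"] \<sigma>[of k] \<sigma>(1)[of "Suc k"] h(2) d2 by (simp add: \<sigma>_def)
  qed (use assms(2) in \<open>auto simp: u_def\<close>)
  moreover have L': "n' * (n * M) = L" by (simp add: L_def)
  moreover have "theta_homotopic \<theta> X (map (p \<circ> \<tau>) [0..<Suc L]) (map (q \<circ> \<sigma>) [0..<Suc L])"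
  proof (rule theta_homotopic_gridI[where n = L and m = M])
    \<comment> \<open>Time moves linearly from \<open>\<tau>\<close> to \<open>\<sigma>\<close>
      while the homotopy parameter moves from 0 to 1. Both time sequences start at 0 and end at 1,
      so the end columns stay on the sides where \<open>h\<close> is constant.\<close>
    define mix where "mix i j = (1 - real j / real M) * \<tau> i + real j / real M * \<sigma> i" for i j
    have r01: "real j / real M \<in> {0..1}" if "j \<le> M" for j using that M by simp
    have mix01: "mix i j \<in> {0..1}" if "j \<le> M" for i j
    proof -
      have "0 \<le> real j / real M" "real j / real M \<le> 1" using r01[OF that] by auto
      moreover from this have "mix i j \<le> 1" unfolding mix_def
        using \<tau>(1)[of i] \<sigma>(1)[of i] by (intro convex_bound_le) auto
      ultimately show ?thesis using \<tau>(1)[of i] \<sigma>(1)[of i] unfolding mix_def by simp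
    qed
    have \<tau>_ends: "\<tau> 0 = 0" "\<tau> L = 1"
      using ts(1-3) n n' M refine_times_mult[of "n' * M" t 0] refine_times_mult[of "n' * M" t n]
      by (auto simp: \<tau>_def L_def t_def fine_times_def hd_conv_nth last_conv_nth)
    have \<sigma>_ends: "\<sigma> 0 = 0" "\<sigma> L = 1"
      using us(1-3) n n' M refine_times_mult[of "n * M" u 0] refine_times_mult[of "n * M" u n']
      unfolding L'[symmetric]
      by (auto simp: \<sigma>_def u_def fine_times_def hd_conv_nth last_conv_nth)
    let ?H = "\<lambda>i j. h (real j / real M, mix i j)"
    have nth: "map f [0..<Suc L] ! i = f i" if "i \<le> L" for f :: "nat \<Rightarrow> 'a" and i
      using that by (subst nth_map) (auto simp del: upt_Suc)
    show "?H i j \<in> X" if "j \<le> M" for i j using hc(2) r01[OF that] mix01[OF that] by auto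
    show "dist (?H i j) (?H (Suc i) j) \<le> \<theta>" if "j \<le> M" for i j
    proof (rule hd)
      let ?r = "real j / real M"
      have r: "0 \<le> ?r" "?r \<le> 1" using r01[OF that] by auto
      have "mix i j - mix (Suc i) j = (1 - ?r) * (\<tau> i - \<tau> (Suc i)) + ?r * (\<sigma> i - \<sigma> (Suc i))"
        by (simp add: mix_def algebra_simps)
      moreover have "\<bar>(1 - ?r) * (\<tau> i - \<tau> (Suc i)) + ?r * (\<sigma> i - \<sigma> (Suc i))\<bar>
          \<le> (1 - ?r) * \<bar>\<tau> i - \<tau> (Suc i)\<bar> + ?r * \<bar>\<sigma> i - \<sigma> (Suc i)\<bar>"
        using r by (intro order_trans[OF abs_triangle_ineq]) (simp add: abs_mult)
      moreover have "\<dots> < d / 2"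
        using r \<tau>(2)[of i] \<sigma>(2)[of i] by (intro convex_bound_lt) auto
      ultimately show "\<bar>mix i j - mix (Suc i) j\<bar> < d / 2" by (metis order_le_less_trans)
    qed (use r01[OF that] mix01[OF that] d2 in auto)
    show "dist (?H i j) (?H i (Suc j)) \<le> \<theta>" if "j < M" for i j
    proof (rule hd)
      have 1: "real j / real M - real (Suc j) / real M = - (1 / real M)"
        using M by (simp add: field_simps)
      then show "\<bar>real j / real M - real (Suc j) / real M\<bar> < d / 2" using Md by simp
      have "mix i j - mix i (Suc j) = (real j / real M - real (Suc j) / real M) * (\<sigma> i - \<tau> i)"
        unfolding mix_def by algebra
      then have "\<bar>mix i j - mix i (Suc j)\<bar> = 1 / real M * \<bar>\<sigma> i - \<tau> i\<bar>" unfolding 1 by (simp add: abs_mult)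
      also have "\<dots> \<le> 1 / real M * 1"
        using \<tau>(1)[of i] \<sigma>(1)[of i] by (intro mult_left_mono) auto
      finally show "\<bar>mix i j - mix i (Suc j)\<bar> < d / 2" using Md by simp
    qed (use r01[of j] r01[of "Suc j"] mix01[of j] mix01[of "Suc j"] that in auto)
    show "?H i 0 = map (p \<circ> \<tau>) [0..<Suc L] ! i" if "i \<le> L" for i
      unfolding nth[OF that] using h(1)[OF \<tau>(1)] by (simp add: mix_def)
    show "?H i M = map (q \<circ> \<sigma>) [0..<Suc L] ! i" if "i \<le> L" for i
      unfolding nth[OF that] using h(2)[OF \<sigma>(1)] M by (simp add: mix_def)
    show "?H 0 j = map (p \<circ> \<tau>) [0..<Suc L] ! 0" if "j \<le> M" for j
      unfolding nth[OF le0] using h(3)[OF r01[OF that]] by (simp add: mix_def \<tau>_ends \<sigma>_ends)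
    show "?H L j = map (p \<circ> \<tau>) [0..<Suc L] ! L" if "j \<le> M" for j
      unfolding nth[OF order_refl] using h(4)[OF r01[OF that]] by (simp add: mix_def \<tau>_ends \<sigma>_ends)
  qed simp_all
  ultimately show ?thesis unfolding L' L_def[symmetric]
    by (metis theta_homotopic_trans theta_homotopic_sym)
qed

section \<open>Reparametrisation and segments of paths\<close>

text \<open>The straight-line homotopy between the two parametrisations stays in the convex set
  \<open>{0..1}\<close>; composing it with \<open>g\<close> keeps everything inside the image of
  \<open>g\<close>.\<close>

lemma homotopic_paths_comp:
  fixes \<phi> \<psi> :: "real \<Rightarrow> real"
  assumes "path g" "path_image g \<subseteq> X"
    and "continuous_on {0..1} \<phi>" "continuous_on {0..1} \<psi>"
    and "\<And>t. t \<in> {0..1} \<Longrightarrow> \<phi> t \<in> {0..1}" "\<And>t. t \<in> {0..1} \<Longrightarrow> \<psi> t \<in> {0..1}"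
    and "\<phi> 0 = \<psi> 0" "\<phi> 1 = \<psi> 1"
  shows "homotopic_paths X (g \<circ> \<phi>) (g \<circ> \<psi>)"
proof -
  define f where "f = (\<lambda>z::real \<times> real. (1 - fst z) * \<phi> (snd z) + fst z * \<psi> (snd z))"
  have c: "continuous_on ({0..1} \<times> {0..1}) f"
    unfolding f_def using assms(3,4)
    by (intro continuous_intros continuous_on_compose2[OF assms(3)] continuous_on_compose2[OF assms(4)]) auto
  have rng: "f z \<in> {0..1}" if "z \<in> {0..1} \<times> {0..1}" for z
  proof -
    have "\<phi> (snd z) \<in> {0..1}" "\<psi> (snd z) \<in> {0..1}" "0 \<le> fst z" "fst z \<le> 1"
      using that assms(5,6)[of "snd z"] by (simp_all add: mem_Times_iff)
    then show ?thesis unfolding f_def by (auto intro: convex_bound_le)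
  qed
  have "f (s, 0) = \<phi> 0" "f (s, 1) = \<phi> 1" for s
    using assms(7,8) by (simp_all add: f_def algebra_simps)
  moreover have "continuous_on ({0..1} \<times> {0..1}) (g \<circ> f)"
    using assms(1) c rng unfolding path_def
    by (intro continuous_on_compose) (auto intro: continuous_on_subset)
  moreover have "g \<circ> f \<in> {0..1} \<times> {0..1} \<rightarrow> X"
    using assms(2) rng unfolding path_image_def by auto
  ultimately show ?thesis unfolding homotopic_paths
    by (intro exI[of _ "g \<circ> f"]) (auto simp: pathstart_def pathfinish_def f_def)
qed

lemma homotopic_paths_const_right:
  assumes "path p" "path_image p \<subseteq> X"
  shows "homotopic_paths X (p +++ (\<lambda>_. pathfinish p)) p"
proof -
  have "homotopic_paths X (p \<circ> (\<lambda>t. min 1 (2 * t))) (p \<circ> id)"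
    using assms by (intro homotopic_paths_comp) (auto intro!: continuous_intros)
  moreover have "(p +++ (\<lambda>_. pathfinish p)) = p \<circ> (\<lambda>t. min 1 (2 * t))"
  proof
    fix t :: real
    have "2 * t = 1 \<or> 2 * t < 1 \<or> 2 * t > 1" by linarith
    then show "(p +++ (\<lambda>_. pathfinish p)) t = (p \<circ> (\<lambda>t. min 1 (2 * t))) t"
      by (auto simp: joinpaths_def pathfinish_def)
  qed
  ultimately show ?thesis by simp
qed

text \<open>
  The library's \<open>subpath\<close> is confined to normed vector spaces.
\<close>

definition path_segment :: "real \<Rightarrow> real \<Rightarrow> (real \<Rightarrow> 'a) \<Rightarrow> real \<Rightarrow> 'a" where
  "path_segment u v g = g \<circ> (\<lambda>t. u + (v - u) * t)"

lemma path_segment_ends [simp]: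
  "pathstart (path_segment u v g) = g u" "pathfinish (path_segment u v g) = g v"
  by (simp_all add: path_segment_def pathstart_def pathfinish_def)

lemma path_segment_trivial [simp]: "path_segment 0 1 g = g" "path_segment u u g = (\<lambda>_. g u)"
  by (simp_all add: path_segment_def fun_eq_iff)

lemma path_segment:
  fixes g :: "real \<Rightarrow> 'a::topological_space"
  assumes "path g" "u \<in> {0..1}" "v \<in> {0..1}" "u \<le> v"
  shows "path (path_segment u v g)" "path_image (path_segment u v g) \<subseteq> g ` {u..v}"
proof -
  have rng: "u + (v - u) * x \<in> {u..v}" if "x \<in> {0..1}" for x
    using that assms(4) mult_left_le[of x "v - u"] by auto
  then show "path_image (path_segment u v g) \<subseteq> g ` {u..v}"
    unfolding path_image_def path_segment_def by auto
  have "(\<lambda>t. u + (v - u) * t) ` {0..1} \<subseteq> {0..1}" using assms(2,3) rng by fastforce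
  then show "path (path_segment u v g)"
    using assms(1) unfolding path_def path_segment_def
    by (intro continuous_on_compose continuous_intros) (rule continuous_on_subset)
qed

lemma homotopic_join_path_segments:
  fixes g :: "real \<Rightarrow> 'a::topological_space"
  assumes g: "path g" "path_image g \<subseteq> X" and uvw: "0 \<le> u" "u \<le> v" "v \<le> w" "w \<le> 1"
  shows "homotopic_paths X (path_segment u v g +++ path_segment v w g) (path_segment u w g)"
proof -
  \<comment> \<open>The two halves of the joined path as a single formula: the \<open>min\<close>
    term runs over \<open>u\<close> to \<open>v\<close> and then rests, the \<open>max\<close> term
    rests and then runs over \<open>v\<close> to \<open>w\<close>. Continuity is immediate in this
    form.\<close>
  let ?\<phi> = "\<lambda>t. u + (v - u) * min 1 (2 * t) + (w - v) * max 0 (2 * t - 1)"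
  let ?\<psi> = "\<lambda>t. u + (w - u) * t"
  have "?\<phi> t \<in> {0..1}" "?\<psi> t \<in> {0..1}" if "t \<in> {0..1}" for t
  proof -
    have "0 \<le> (v - u) * min 1 (2 * t)" "(v - u) * min 1 (2 * t) \<le> v - u"
      "0 \<le> (w - v) * max 0 (2 * t - 1)" "(w - v) * max 0 (2 * t - 1) \<le> w - v"
      "0 \<le> (w - u) * t" "(w - u) * t \<le> w - u"
      using uvw that by (auto intro!: mult_nonneg_nonneg mult_left_le)
    then show "?\<phi> t \<in> {0..1}" "?\<psi> t \<in> {0..1}" using uvw by auto
  qed
  then have "homotopic_paths X (g \<circ> ?\<phi>) (g \<circ> ?\<psi>)"
    using g by (intro homotopic_paths_comp) (auto intro!: continuous_intros)
  moreover have "path_segment u v g +++ path_segment v w g = g \<circ> ?\<phi>"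
  proof
    fix t :: real
    show "(path_segment u v g +++ path_segment v w g) t = (g \<circ> ?\<phi>) t"
      by (cases "t \<le> 1/2") (simp_all add: joinpaths_def path_segment_def min_def max_def algebra_simps)
  qed
  moreover have "path_segment u w g = g \<circ> ?\<psi>" by (simp add: path_segment_def)
  ultimately show ?thesis by simp
qed

section \<open>Discretising a concatenation\<close>

text \<open>The times are rescaled to the two halves of the unit interval. Both rescaled lists
  contain 1/2, as last and as first entry, and \<open>tl\<close> drops the duplicate, just as
  concatenation of discrete paths does.\<close>

lemma fine_times_join:
  assumes ts: "fine_times \<theta> p ts" "last ts = 1" and us: "fine_times \<theta> q us" "hd us = 0"
    and pq: "pathfinish p = pathstart q"
  shows "fine_times \<theta> (p +++ q) (map (\<lambda>t. t / 2) ts @ tl (map (\<lambda>u. (1 + u) / 2) us))"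
    and "map (p +++ q) (map (\<lambda>t. t / 2) ts @ tl (map (\<lambda>u. (1 + u) / 2) us)) = map p ts @ tl (map q us)"
proof -
  let ?A = "map (\<lambda>t. t / 2) ts" and ?B = "map (\<lambda>u. (1 + u) / 2) us"
  have ne: "ts \<noteq> []" "us \<noteq> []" and 01: "set ts \<subseteq> {0..1}" "set us \<subseteq> {0..1}"
    and sorted: "sorted ts" "sorted us"
    using ts us by (auto simp: fine_times_def)
  have ends: "last ?A = hd ?B" using ts us ne by (simp add: last_map hd_map)
  have l: "(p +++ q) (t / 2) = p t" if "t \<le> 1" for t
    using that by (simp add: joinpaths_def)
  have r: "(p +++ q) ((1 + u) / 2) = q u" if "0 \<le> u" for u
    using that pq by (cases "u = 0") (auto simp: joinpaths_def pathstart_def pathfinish_def add_divide_distrib)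
  have "set (tl us) \<subseteq> {0..1}" using 01(2) ne(2) by (cases us) auto
  then show "map (p +++ q) (?A @ tl ?B) = map p ts @ tl (map q us)"
    using 01(1) l r by (auto simp: subset_iff simp flip: map_tl)
  show "fine_times \<theta> (p +++ q) (?A @ tl ?B)"
    unfolding fine_times_def
  proof (intro conjI allI impI)
    show "?A @ tl ?B \<noteq> []" using ne by simp
    have "sorted ?A" using sorted(1) by (intro sorted_map_mono mono_onI) auto
    moreover have "sorted (tl ?B)"
      using sorted(2) by (intro sorted_tl sorted_map_mono mono_onI) auto
    moreover have "a \<le> 1/2" if "a \<in> set ?A" for a using that 01(1) by auto
    moreover have B: "1/2 \<le> b \<and> b \<le> 1" if "b \<in> set (tl ?B)" for b
      using that 01(2) ne(2) by (cases us) auto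
    ultimately show "sorted (?A @ tl ?B)" unfolding sorted_append by fastforce
    show "set (?A @ tl ?B) \<subseteq> {0..1}" using 01(1) B by fastforce
    fix i assume i: "Suc i < length (?A @ tl ?B)"
    then have i': "Suc i < length ?A + length ?B - 1" using ne by (cases us) auto
    show "(p +++ q) ` {(?A @ tl ?B) ! i..(?A @ tl ?B) ! Suc i} \<subseteq> cball ((p +++ q) ((?A @ tl ?B) ! i)) \<theta>"
    proof (cases "Suc i < length ts")
      case True
      note f = fine_times_nth[OF ts(1) True]
      have eq: "(?A @ tl ?B) ! i = ts ! i / 2" "(?A @ tl ?B) ! Suc i = ts ! Suc i / 2"
        using True by (simp_all add: nth_append)
      have "(p +++ q) s \<in> cball (p (ts ! i)) \<theta>" if "s \<in> {ts ! i / 2..ts ! Suc i / 2}" for s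
      proof -
        have "2 * s \<in> {ts ! i..ts ! Suc i}" "2 * s \<le> 1" using that f(2) by auto
        then show ?thesis using l[of "2 * s"] f(4) by (simp add: image_subset_iff)
      qed
      then show ?thesis unfolding eq using l[of "ts ! i"] f(1) by (auto simp del: mem_cball)
    next
      case False
      \<comment> \<open>The interval starting at index \<open>length ts - 1\<close> already belongs
        to the second path: the last time of the first list is read as the first time of the
        second.\<close>
      define j where "j = i - (length ts - 1)"
      have j: "Suc j < length us" "Suc i - (length ts - 1) = Suc j"
        using False i' ne by (cases ts; auto simp: j_def)+
      note f = fine_times_nth[OF us(1) j(1)]
      have "(?A @ tl ?B) ! i = ?B ! j" "(?A @ tl ?B) ! Suc i = ?B ! Suc j"
        using nth_append_tl(2)[of ?A ?B i] nth_append_tl(2)[of ?A ?B "Suc i"] ne ends i' False j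
        by (auto simp: j_def)
      then have eq: "(?A @ tl ?B) ! i = (1 + us ! j) / 2" "(?A @ tl ?B) ! Suc i = (1 + us ! Suc j) / 2"
        using j(1) by auto
      have "(p +++ q) s \<in> cball (q (us ! j)) \<theta>"
        if "s \<in> {(1 + us ! j) / 2..(1 + us ! Suc j) / 2}" for s
      proof -
        have "2 * s - 1 \<in> {us ! j..us ! Suc j}" "0 \<le> 2 * s - 1" using that f(1) by (auto simp: field_simps)
        then show ?thesis using r[of "2 * s - 1"] f(4) by (simp add: image_subset_iff)
      qed
      then show ?thesis unfolding eq using r[of "us ! j"] f(1) by (auto simp del: mem_cball)
    qed
  qed
qed

lemma theta_discretisation_join:
  assumes "path p" "path q" "pathfinish p = pathstart q" "0 \<le> \<theta>"
    and "theta_discretisation \<theta> p Z" "theta_discretisation \<theta> q W"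
  shows "theta_discretisation \<theta> (p +++ q) (Z @ tl W)"
proof -
  obtain ts us where ts: "fine_times \<theta> p ts" "hd ts = 0" "last ts = 1" "Z = map p ts"
    and us: "fine_times \<theta> q us" "hd us = 0" "last us = 1" "W = map q us"
    using assms by (auto simp: theta_discretisation_iff_fine_times)
  let ?vs = "map (\<lambda>t. t / 2) ts @ tl (map (\<lambda>u. (1 + u) / 2) us)"
  have ne: "ts \<noteq> []" "us \<noteq> []" using ts us by (auto simp: fine_times_def)
  have "hd ?vs = 0" using ne ts(2) by (simp add: hd_map)
  moreover have "last ?vs = 1"
  proof (cases "tl us = []")
    case True
    then have "us = [hd us]" using ne by (cases us) auto
    then have "last us = hd us" by (metis last_ConsL)
    then show ?thesis using us by simp
  next
    case False
    then show ?thesis using us(3) by (simp add: last_append last_tl last_map flip: map_tl)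
  qed
  ultimately show ?thesis
    using fine_times_join[OF ts(1,3) us(1,2) assms(3)] ts(4) us(4) assms
    by (subst theta_discretisation_iff_fine_times) auto
qed

lemma theta_discretisation_two_point:
  assumes "path g" "path_image g \<subseteq> cball (pathstart g) \<theta>" "0 \<le> \<theta>"
  shows "theta_discretisation \<theta> g [pathstart g, pathfinish g]"
  unfolding theta_discretisation_def
proof (intro exI[of _ "[0, 1]"] conjI allI impI)
  fix i assume "Suc i < length [0::real, 1]"
  then show "g ` {[0, 1] ! i<..<[0, 1] ! Suc i} \<subseteq> cball (g ([0, 1] ! i)) \<theta>"
    using assms by (auto simp: path_image_def pathstart_def image_subset_iff)
qed (auto simp: pathstart_def pathfinish_def)

section \<open>Tracing discrete paths by continuous ones\<close>

text \<open>The ball is closed and centred at the first point, which is the shape of a cell in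
  \<open>theta_discretisation\<close>.\<close>

definition close_points_joined :: "'a::metric_space set \<Rightarrow> real \<Rightarrow> real \<Rightarrow> bool" where
  "close_points_joined X \<theta> r \<longleftrightarrow> (\<forall>x\<in>X. \<forall>y\<in>X. dist x y \<le> \<theta> \<longrightarrow>
     (\<exists>g. path g \<and> path_image g \<subseteq> X \<inter> cball x r \<and> pathstart g = x \<and> pathfinish g = y))"

text \<open>Semi-local simple connectedness restated for two paths with common ends instead of
  loops; this is the form in which a square of a ladder is filled.\<close>

definition short_paths_homotopic :: "'a::metric_space set \<Rightarrow> real \<Rightarrow> bool" where
  "short_paths_homotopic X r \<longleftrightarrow> (\<forall>x\<in>X. \<forall>g h. path g \<and> path h \<and>
     path_image g \<subseteq> X \<inter> cball x r \<and> path_image h \<subseteq> X \<inter> cball x r \<and>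
     pathstart g = pathstart h \<and> pathfinish g = pathfinish h \<longrightarrow> homotopic_paths X g h)"

text \<open>Joining paths of consecutive points are concatenated, each contributing a cell with the
  times 0 and 1. A single point is excluded because these two times give at least two
  entries.\<close>

lemma ex_realisation:
  assumes conn: "close_points_joined X \<theta> \<epsilon>" and "0 \<le> \<epsilon>"
  shows "theta_path \<theta> X Z \<Longrightarrow> 2 \<le> length Z \<Longrightarrow>
    \<exists>g. path g \<and> path_image g \<subseteq> X \<and> theta_discretisation \<epsilon> g Z"
proof (induction Z rule: induct_list012)
  case (3 x y Z)
  have xy: "x \<in> X" "y \<in> X" "dist x y \<le> \<theta>"
    using 3(3) by (auto simp: theta_path_def dest: spec[of _ 0])
  then obtain g where g: "path g" "path_image g \<subseteq> X \<inter> cball x \<epsilon>" "pathstart g = x" "pathfinish g = y"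
    using conn unfolding close_points_joined_def by blast
  then have disc: "theta_discretisation \<epsilon> g [x, y]"
    using theta_discretisation_two_point[of g \<epsilon>] assms(2) by auto
  show ?case
  proof (cases "Z = []")
    case True
    then show ?thesis using g disc by auto
  next
    case False
    have tail: "theta_path \<theta> X (y # Z)" unfolding theta_path_def
    proof (intro conjI allI impI)
      fix i assume "Suc i < length (y # Z)"
      then show "dist ((y # Z) ! i) ((y # Z) ! Suc i) \<le> \<theta>"
        using 3(3) unfolding theta_path_def by (auto dest: spec[of _ "Suc i"])
    qed (use 3(3) in \<open>auto simp: theta_path_def\<close>)
    moreover have "2 \<le> length (y # Z)" using False by (cases Z) auto
    ultimately obtain h where h: "path h" "path_image h \<subseteq> X" "theta_discretisation \<epsilon> h (y # Z)"
      using 3(2) by blast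
    have start: "pathstart h = y"
      using theta_discretisation_theta_path(2)[OF h(1,2) assms(2) h(3)] by simp
    have "theta_discretisation \<epsilon> (g +++ h) ([x, y] @ tl (y # Z))"
      using g h start assms(2) disc by (intro theta_discretisation_join) auto
    moreover have "path (g +++ h)" "path_image (g +++ h) \<subseteq> X"
      using g h start by (auto simp: subset_path_image_join)
    ultimately show ?thesis by auto
  qed
qed auto

text \<open>
  \<open>tracks r X g Z\<close>: up to homotopy in \<open>X\<close>, the path \<open>g\<close> runs through the points of \<open>Z\<close> in order,
  the part from \<open>x\<close> to the next point staying in the closed ball of radius \<open>r\<close> around \<open>x\<close>.
\<close>

fun tracks :: "real \<Rightarrow> 'a::metric_space set \<Rightarrow> (real \<Rightarrow> 'a) \<Rightarrow> 'a list \<Rightarrow> bool" where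
  "tracks r X g [] \<longleftrightarrow> False"
| "tracks r X g [x] \<longleftrightarrow> homotopic_paths X g (\<lambda>_. x)"
| "tracks r X g (x # y # Z) \<longleftrightarrow> (\<exists>g1 g2. path g1 \<and> path_image g1 \<subseteq> X \<inter> cball x r \<and>
     pathstart g1 = x \<and> pathfinish g1 = y \<and> tracks r X g2 (y # Z) \<and> homotopic_paths X g (g1 +++ g2))"

lemma tracks_path:
  assumes "tracks r X g Z"
  shows "path g \<and> path_image g \<subseteq> X \<and> pathstart g = hd Z \<and> pathfinish g = last Z"
  using assms
proof (induction r X g Z rule: tracks.induct)
  case (2 r X g x)
  then have g: "homotopic_paths X g (\<lambda>_. x)" by simp
  show ?case
    using homotopic_paths_imp_path[OF g] homotopic_paths_imp_subset[OF g]
      homotopic_paths_imp_pathstart[OF g] homotopic_paths_imp_pathfinish[OF g]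
    by (simp add: pathstart_def pathfinish_def)
next
  case (3 r X g x y Z)
  then obtain g1 g2 where g: "pathstart g1 = x" "tracks r X g2 (y # Z)" "homotopic_paths X g (g1 +++ g2)"
    by auto
  then show ?case
    using 3(1)[OF g(2)] homotopic_paths_imp_path[OF g(3)] homotopic_paths_imp_subset[OF g(3)]
      homotopic_paths_imp_pathstart[OF g(3)] homotopic_paths_imp_pathfinish[OF g(3)]
    by auto
qed simp

text \<open>Removing the first time leaves a list that starts later, so the induction speaks of the
  segment between the extreme times. For this reason \<open>fine_times\<close> does not fix the ends
  to be 0 and 1.\<close>

lemma tracks_path_segment:
  fixes g :: "real \<Rightarrow> 'a::metric_space"
  assumes "path g" "path_image g \<subseteq> X"
  shows "fine_times r g ts \<Longrightarrow> tracks r X (path_segment (hd ts) (last ts) g) (map g ts)"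
proof (induction ts rule: induct_list012)
  case (2 t)
  then have "g t \<in> X" using assms(2) by (auto simp: fine_times_def path_image_def)
  then show ?case by (auto simp: path_def path_image_def)
next
  case (3 t u ts)
  have tu: "t \<in> {0..1}" "u \<in> {0..1}" "t \<le> u" "g ` {t..u} \<subseteq> cball (g t) r"
    using fine_times_nth[OF 3(3), of 0] by simp_all
  have "fine_times r g (u # ts)" unfolding fine_times_def
  proof (intro conjI allI impI)
    fix i assume "Suc i < length (u # ts)"
    then show "g ` {(u # ts) ! i..(u # ts) ! Suc i} \<subseteq> cball (g ((u # ts) ! i)) r"
      using fine_times_nth(4)[OF 3(3), of "Suc i"] by simp
  qed (use 3(3) in \<open>auto simp: fine_times_def\<close>)
  then have IH: "tracks r X (path_segment u (last (u # ts)) g) (map g (u # ts))"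
    using 3(2) by simp
  have w: "u \<le> last (u # ts)" "last (u # ts) \<le> 1"
    using 3(3) last_in_set[of "u # ts"] by (auto simp: fine_times_def subset_iff)
  have "g ` {t..u} \<subseteq> path_image g" using tu unfolding path_image_def by (intro image_mono) auto
  then have "path_image (path_segment t u g) \<subseteq> X \<inter> cball (g t) r"
    using path_segment(2)[OF assms(1) tu(1,2,3)] tu(4) assms(2) by blast
  moreover have "path (path_segment t u g)" using path_segment(1)[OF assms(1) tu(1,2,3)] .
  moreover have "homotopic_paths X (path_segment t (last (u # ts)) g)
      (path_segment t u g +++ path_segment u (last (u # ts)) g)"
    using assms tu w by (intro homotopic_paths_sym[OF homotopic_join_path_segments]) auto
  ultimately have "tracks r X (path_segment t (last (u # ts)) g) (g t # g u # map g ts)"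
    using IH unfolding tracks.simps list.map
    by (intro exI[of _ "path_segment t u g"] exI[of _ "path_segment u (last (u # ts)) g"]) auto
  then show ?case by simp
qed (simp add: fine_times_def)

lemma tracks_of_discretisation:
  assumes "path g" "path_image g \<subseteq> X" "theta_discretisation r g Z" "0 \<le> r"
  shows "tracks r X g Z"
proof -
  obtain ts where "fine_times r g ts" "hd ts = 0" "last ts = 1" "Z = map g ts"
    using assms by (auto simp: theta_discretisation_iff_fine_times)
  then show ?thesis using tracks_path_segment[OF assms(1,2), of r ts] by simp
qed

lemma short_paths_homotopicD:
  assumes "short_paths_homotopic X r" "x \<in> X" "path g" "path h"
    and "path_image g \<subseteq> X \<inter> cball x r" "path_image h \<subseteq> X \<inter> cball x r"
    and "pathstart g = pathstart h" "pathfinish g = pathfinish h"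
  shows "homotopic_paths X g h"
  using assms unfolding short_paths_homotopic_def by blast

section \<open>From discrete homotopies to homotopies of paths\<close>

text \<open>The last rung \<open>c'\<close> is fixed, the first rung \<open>c\<close> varies in the
  induction. With a rung \<open>d\<close> at the next points, the first square replaces
  \<open>g1 +++ d\<close> by \<open>c +++ h1\<close>, and the induction hypothesis moves
  \<open>d\<close> along the remaining paths. At the last points the current rung is compared with
  \<open>c'\<close>. The radius doubles because \<open>d\<close> and \<open>h1\<close> stay within
  \<open>r\<close> of points that are themselves within \<open>r\<close> of
  \<open>x\<close>.\<close>

lemma tracks_ladder:
  assumes short: "short_paths_homotopic X (2 * r)" and conn: "close_points_joined X \<eta> r" and "0 \<le> r"
    and c': "path c'" "path_image c' \<subseteq> X \<inter> cball (pathstart c') r"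
  shows "tracks r X g Z \<Longrightarrow> tracks r X h W \<Longrightarrow> list_all2 (\<lambda>x y. dist x y \<le> \<eta>) Z W \<Longrightarrow>
    path c \<Longrightarrow> path_image c \<subseteq> X \<inter> cball (pathstart c) r \<Longrightarrow> pathstart c = hd Z \<Longrightarrow>
    pathfinish c = hd W \<Longrightarrow> pathstart c' = last Z \<Longrightarrow> pathfinish c' = last W \<Longrightarrow>
    homotopic_paths X (g +++ c') (c +++ h)"
proof (induction Z arbitrary: g h W c)
  case (Cons x Z)
  obtain x' W' where W: "W = x' # W'" "dist x x' \<le> \<eta>" "list_all2 (\<lambda>x y. dist x y \<le> \<eta>) Z W'"
    using Cons.prems(3) by (auto simp: list_all2_Cons1)
  have cp: "path c" "path_image c \<subseteq> X \<inter> cball x r" "pathstart c = x" "pathfinish c = x'"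
    using Cons.prems W by auto
  have xx': "x \<in> X" "x' \<in> X" "x' \<in> cball x r"
    using cp pathstart_in_path_image[of c] pathfinish_in_path_image[of c] by auto
  note g = tracks_path[OF Cons.prems(1)] and h = tracks_path[OF Cons.prems(2)]
  have big: "cball y r \<subseteq> cball x (2 * r)" if "y \<in> cball x r" for x y :: 'a
  proof
    fix z assume "z \<in> cball y r"
    then show "z \<in> cball x (2 * r)" using that dist_triangle[of x z y] by simp
  qed
  have cx: "path_image c \<subseteq> X \<inter> cball x (2 * r)" using cp(2) big[of x x] \<open>0 \<le> r\<close> by auto
  show ?case
  proof (cases Z)
    case Nil
    then have nil: "Z = []" "W' = []" using W(3) by auto
    have c'x: "pathstart c' = x" "pathfinish c' = x'" using Cons.prems(8,9) nil W by auto
    have "path_image c' \<subseteq> X \<inter> cball x (2 * r)" using c'(2) c'x big[of x x] \<open>0 \<le> r\<close> by auto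
    then have cc': "homotopic_paths X c' c"
      using short c'(1) cp cx xx'(1) c'x by (intro short_paths_homotopicD) auto
    have gx: "homotopic_paths X g (\<lambda>_. x)" and hx: "homotopic_paths X h (\<lambda>_. x')"
      using Cons.prems(1,2) nil W(1) by auto
    have "homotopic_paths X (g +++ c') ((\<lambda>_. x) +++ c')"
      using gx c' g c'x nil by (intro homotopic_paths_join) auto
    moreover have "homotopic_paths X ((\<lambda>_. x) +++ c') c'"
      using homotopic_paths_const_left[of c' X] c' c'x by auto
    moreover have "homotopic_paths X c (c +++ (\<lambda>_. x'))"
      using homotopic_paths_sym[OF homotopic_paths_const_right[of c X]] cp by auto
    moreover have "homotopic_paths X (c +++ (\<lambda>_. x')) (c +++ h)"
      using homotopic_paths_sym[OF hx] cp nil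
      by (intro homotopic_paths_join) (auto simp: pathstart_def)
    ultimately show ?thesis using cc' by (meson homotopic_paths_trans)
  next
    case (Cons y V)
    then obtain y' V' where W': "W' = y' # V'" "dist y y' \<le> \<eta>"
      using W(3) by (auto simp: list_all2_Cons1)
    obtain g1 g2 where g12: "path g1" "path_image g1 \<subseteq> X \<inter> cball x r" "pathstart g1 = x"
      "pathfinish g1 = y" "tracks r X g2 Z" "homotopic_paths X g (g1 +++ g2)"
      using Cons.prems(1) Cons by auto
    obtain h1 h2 where h12: "path h1" "path_image h1 \<subseteq> X \<inter> cball x' r" "pathstart h1 = x'"
      "pathfinish h1 = y'" "tracks r X h2 W'" "homotopic_paths X h (h1 +++ h2)"
      using Cons.prems(2) W(1) W' by auto
    note g2 = tracks_path[OF g12(5)] and h2 = tracks_path[OF h12(5)]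
    have yy': "y \<in> X" "y' \<in> X" "y \<in> cball x r"
      using g12 h12 pathfinish_in_path_image[of g1] pathfinish_in_path_image[of h1] by auto
    obtain d where d: "path d" "path_image d \<subseteq> X \<inter> cball y r" "pathstart d = y" "pathfinish d = y'"
      using conn yy' W'(2) unfolding close_points_joined_def by blast
    have ends: "pathstart g2 = y" "pathstart h2 = y'" "pathfinish g2 = pathstart c'"
      using g2 h2 Cons W' Cons.prems(8) by auto
    have c'X: "path_image c' \<subseteq> X" using c' by auto
    have X: "path_image g1 \<subseteq> X" "path_image h1 \<subseteq> X" "path_image c \<subseteq> X" "path_image d \<subseteq> X"
      using g12 h12 cp d by auto
    have IH: "homotopic_paths X (g2 +++ c') (d +++ h2)"
      using Cons.prems(8,9) Cons W' W(1,3) d by (intro Cons.IH[OF g12(5) h12(5)]) auto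
    have "homotopic_paths X (g1 +++ d) (c +++ h1)"
    proof (rule short_paths_homotopicD[OF short xx'(1)])
      have "cball x r \<subseteq> cball x (2 * r)" using big[of x x] \<open>0 \<le> r\<close> by auto
      then show "path_image (g1 +++ d) \<subseteq> X \<inter> cball x (2 * r)"
        using big[OF yy'(3)] g12(2) d(2) by (intro subset_path_image_join) blast+
      show "path_image (c +++ h1) \<subseteq> X \<inter> cball x (2 * r)"
        using big[OF xx'(3)] h12(2) cx by (intro subset_path_image_join) blast+
    qed (use g12 d cp h12 in auto)
    then have square: "homotopic_paths X ((g1 +++ d) +++ h2) ((c +++ h1) +++ h2)"
      by (rule homotopic_paths_join) (use h2 ends d in auto)
    have "homotopic_paths X (g +++ c') ((g1 +++ g2) +++ c')"
      by (rule homotopic_paths_join[OF g12(6)]) (use c' c'X g Cons.prems(8) in auto)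
    also have "homotopic_paths X ((g1 +++ g2) +++ c') (g1 +++ (g2 +++ c'))"
      using g12 g2 X c' c'X ends by (intro homotopic_paths_sym[OF homotopic_paths_assoc]) auto
    also have "homotopic_paths X (g1 +++ (g2 +++ c')) (g1 +++ (d +++ h2))"
      by (rule homotopic_paths_join[OF _ IH]) (use g12 X ends in auto)
    also have "homotopic_paths X (g1 +++ (d +++ h2)) ((g1 +++ d) +++ h2)"
      using g12 h2 X d ends by (intro homotopic_paths_assoc) auto
    also note square
    also have "homotopic_paths X ((c +++ h1) +++ h2) (c +++ (h1 +++ h2))"
      using cp h12 h2 X ends by (intro homotopic_paths_sym[OF homotopic_paths_assoc]) auto
    also have "homotopic_paths X (c +++ (h1 +++ h2)) (c +++ h)"
      by (rule homotopic_paths_join[OF _ homotopic_paths_sym[OF h12(6)]]) (use cp h12 X in auto)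
    finally show ?thesis .
  qed
qed simp

text \<open>A ladder whose two end rungs are constant. With \<open>Z = W\<close> and a nonnegative
  \<open>\<eta>\<close> it says that a list determines its tracking path up to homotopy.\<close>

lemma homotopic_paths_of_close_tracks:
  assumes short: "short_paths_homotopic X (2 * r)" and conn: "close_points_joined X \<eta> r" and "0 \<le> r"
    and g: "tracks r X g Z" and h: "tracks r X h W"
    and close: "list_all2 (\<lambda>x y. dist x y \<le> \<eta>) Z W" and ends: "hd Z = hd W" "last Z = last W"
  shows "homotopic_paths X g h"
proof -
  note gp = tracks_path[OF g] and hp = tracks_path[OF h]
  have "hd Z \<in> X" "last Z \<in> X"
    using gp pathstart_in_path_image[of g] pathfinish_in_path_image[of g] by auto
  then have "homotopic_paths X (g +++ (\<lambda>_. last Z)) ((\<lambda>_. hd Z) +++ h)"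
    using assms
    by (intro tracks_ladder[OF short conn \<open>0 \<le> r\<close> _ _ g h close])
      (auto simp: path_def path_image_def pathstart_def pathfinish_def)
  moreover have "homotopic_paths X (g +++ (\<lambda>_. last Z)) g"
    using homotopic_paths_const_right[of g X] gp by auto
  moreover have "homotopic_paths X ((\<lambda>_. hd Z) +++ h) h"
    using homotopic_paths_const_left[of h X] hp ends by auto
  ultimately show ?thesis by (meson homotopic_paths_trans homotopic_paths_sym)
qed

text \<open>Repeat the times in the same pattern as the points. A monotone surjection of indices
  skips no value, so consecutive new times are either equal, giving a one-point interval, or
  consecutive old times.\<close>

lemma fine_times_lazification:
  assumes ts: "fine_times \<theta> g ts" and "0 \<le> \<theta>" and laz: "lazification (map g ts) W"
  shows "\<exists>us. fine_times \<theta> g us \<and> hd us = hd ts \<and> last us = last ts \<and> W = map g us"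
proof -
  obtain f where mono: "mono_on {..<length W} f" and im: "f ` {..<length W} = {..<length ts}"
    and W: "\<And>i. i < length W \<Longrightarrow> W ! i = map g ts ! f i" and len: "length ts < length W"
    using laz by (auto simp: lazification_def)
  have ne: "ts \<noteq> []" using ts by (simp add: fine_times_def)
  have flt: "f i < length ts" if "i < length W" for i using im that by blast
  have f_mono: "f i \<le> f j" if "i \<le> j" "j < length W" for i j
    using that by (intro mono_onD[OF mono]) auto
  have f_Suc: "f (Suc i) = f i \<or> f (Suc i) = Suc (f i)" if i: "Suc i < length W" for i
  proof (rule ccontr)
    assume *: "\<not> ?thesis"
    have "f i \<le> f (Suc i)" using f_mono i by simp
    then have lt: "Suc (f i) < f (Suc i)" using * by linarith
    then have "Suc (f i) \<in> f ` {..<length W}" using im flt[OF i] by auto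
    then obtain j where j: "j < length W" "f j = Suc (f i)" by auto
    consider "j \<le> i" | "Suc i \<le> j" by linarith
    then show False
      by cases (use f_mono[of j i] f_mono[of "Suc i" j] j i lt in auto)
  qed
  define us where "us = map (\<lambda>i. ts ! f i) [0..<length W]"
  have us: "us ! i = ts ! f i" if "i < length W" for i using that by (simp add: us_def)
  have lenu: "length us = length W" by (simp add: us_def)
  have Weq: "W = map g us"
    by (rule nth_equalityI) (use W flt us lenu in auto)
  have neu: "us \<noteq> []" using lenu len by auto
  have "lazification ts us" unfolding lazification_def
    using mono im len us lenu by auto
  then have "hd us = hd ts" "last us = last ts" using lazification_ends ne by auto
  moreover have "fine_times \<theta> g us" unfolding fine_times_def
  proof (intro conjI allI impI)
    show "sorted us" unfolding sorted_iff_nth_mono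
      using us lenu f_mono flt ts by (auto simp: fine_times_def intro!: sorted_nth_mono)
    show "set us \<subseteq> {0..1}"
    proof
      fix u assume "u \<in> set us"
      then obtain i where "i < length W" "u = us ! i" using lenu by (auto simp: in_set_conv_nth)
      then have "u \<in> set ts" using us flt by simp
      then show "u \<in> {0..1}" using ts by (auto simp: fine_times_def)
    qed
    fix i assume i: "Suc i < length us"
    have "us ! i = ts ! f i" "us ! Suc i = ts ! f (Suc i)" "f (Suc i) < length ts"
      using us flt i lenu by auto
    then show "g ` {us ! i..us ! Suc i} \<subseteq> cball (g (us ! i)) \<theta>"
      using f_Suc[of i] fine_times_nth(4)[OF ts, of "f i"] i lenu \<open>0 \<le> \<theta>\<close>
      by (auto simp: image_subset_iff)
  qed (rule neu)
  ultimately show ?thesis using Weq by blast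
qed

text \<open>Times are returned, not just a tracking path, because lazifications act on them. A
  single point is covered by a constant path with one time.\<close>

lemma ex_tracks:
  assumes conn: "close_points_joined X \<theta> r" and "0 \<le> r" and Z: "theta_path \<theta> X Z"
  shows "\<exists>g ts. path g \<and> path_image g \<subseteq> X \<and> fine_times r g ts \<and> Z = map g ts"
proof (cases "2 \<le> length Z")
  case True
  then obtain g where "path g" "path_image g \<subseteq> X" "theta_discretisation r g Z"
    using ex_realisation[OF conn \<open>0 \<le> r\<close> Z] by blast
  then show ?thesis using \<open>0 \<le> r\<close> by (auto simp: theta_discretisation_iff_fine_times)
next
  case False
  then obtain x where "Z = [x]" "x \<in> X"
    using Z by (cases Z; cases "tl Z") (auto simp: theta_path_def)
  then show ?thesis
    by (intro exI[of _ "\<lambda>_. x"] exI[of _ "[0]"]) (auto simp: path_def path_image_def fine_times_def)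
qed

lemma homotopic_paths_of_theta_step:
  assumes short: "short_paths_homotopic X (2 * r)" and conn: "close_points_joined X \<theta> r"
    and "0 \<le> r" "0 \<le> \<theta>"
    and ZW: "theta_step \<theta> X Z W" and g: "tracks r X g Z" and h: "tracks r X h W"
  shows "homotopic_paths X g h"
proof -
  \<comment> \<open>It now suffices, for a lazification, to exhibit one path that tracks both
    lists.\<close>
  have same: "homotopic_paths X g h" if "tracks r X g Z" "tracks r X h Z" for g h Z
    using that \<open>0 \<le> \<theta>\<close> by (intro homotopic_paths_of_close_tracks[OF short conn \<open>0 \<le> r\<close>])
      (auto simp: list_all2_conv_all_nth)
  have Zp: "theta_path \<theta> X Z" "theta_path \<theta> X W" using ZW by (auto simp: theta_step_def)
  consider "lazification Z W" | m H where "theta_grid_homotopy \<theta> X Z W m H"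
    using ZW by (auto simp: theta_step_def)
  then show ?thesis
  proof cases
    case 1
    obtain k ts where k: "path k" "path_image k \<subseteq> X" "fine_times r k ts" "Z = map k ts"
      using ex_tracks[OF conn \<open>0 \<le> r\<close> Zp(1)] by blast
    obtain us where us: "fine_times r k us" "hd us = hd ts" "last us = last ts" "W = map k us"
      using fine_times_lazification[OF k(3) \<open>0 \<le> r\<close>] 1 k(4) by blast
    have "tracks r X (path_segment (hd ts) (last ts) k) Z"
      unfolding k(4) by (rule tracks_path_segment[OF k(1,2,3)])
    moreover have "tracks r X (path_segment (hd ts) (last ts) k) W"
      unfolding us(4) us(2,3)[symmetric] by (rule tracks_path_segment[OF k(1,2) us(1)])
    ultimately show ?thesis using same g h by (meson homotopic_paths_trans)
  next
    case 2
    obtain n where len: "length Z = Suc n" "length W = Suc n"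
      and HX: "\<forall>i\<le>n. \<forall>t\<le>m. H i t \<in> X"
      and Hd: "\<forall>i\<le>n. \<forall>i'\<le>n. \<forall>t\<le>m. \<forall>t'\<le>m.
             dist (H i t) (H i' t') \<le> \<theta> * (\<bar>real i - real i'\<bar> + \<bar>real t - real t'\<bar>)"
      and H0: "\<forall>i\<le>n. H i 0 = Z ! i"
      and Hm: "\<forall>i\<le>n. H i m = W ! i"
      and Hs: "\<forall>t\<le>m. H 0 t = Z ! 0 \<and> H 0 t = W ! 0 \<and> H n t = Z ! n \<and> H n t = W ! n"
      using 2 unfolding theta_grid_homotopy_def by (elim exE conjE) (rule that)
    note HX = HX[rule_format] and Hd = Hd[rule_format] and H0 = H0[rule_format]
      and Hm = Hm[rule_format] and Hs = Hs[rule_format]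
    define row where "row t = map (\<lambda>i. H i t) [0..<Suc n]" for t
    have nth: "row t ! i = H i t" if "i \<le> n" for i t
      using that unfolding row_def by (subst nth_map) (auto simp del: upt_Suc)
    have lenr: "length (row t) = Suc n" for t by (simp add: row_def)
    have ner: "row t \<noteq> []" for t using lenr[of t] by auto
    have ends: "hd (row t) = Z ! 0" "last (row t) = Z ! n" if "t \<le> m" for t
      using Hs[OF that] nth ner[of t] lenr[of t] by (simp_all add: hd_conv_nth last_conv_nth)
    have rowp: "theta_path \<theta> X (row t)" if t: "t \<le> m" for t
      unfolding theta_path_def
    proof (intro conjI allI impI ner)
      show "set (row t) \<subseteq> X" using nth lenr HX t by (auto simp: set_conv_nth less_Suc_eq_le)
      show "dist (row t ! i) (row t ! Suc i) \<le> \<theta>" if "Suc i < length (row t)" for i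
        using that Hd[of i "Suc i" t t] nth lenr t by simp
    qed
    have "homotopic_paths X g h" if "t \<le> m" "tracks r X h (row t)" for h t
      using that
    proof (induction t arbitrary: h)
      case 0
      have "row 0 = Z" by (rule nth_equalityI) (use lenr len nth H0 in auto)
      then show ?case using same[OF g] 0 by simp
    next
      case (Suc t)
      \<comment> \<open>Intermediate rows come without a path, so one is chosen; the induction
        hypothesis applies to every path tracking the row.\<close>
      obtain k where k: "tracks r X k (row t)"
        using ex_tracks[OF conn \<open>0 \<le> r\<close> rowp[of t]] tracks_path_segment Suc.prems(1) by (metis Suc_leD)
      have "homotopic_paths X k h"
      proof (rule homotopic_paths_of_close_tracks[OF short conn \<open>0 \<le> r\<close> k Suc.prems(2)])
        show "list_all2 (\<lambda>x y. dist x y \<le> \<theta>) (row t) (row (Suc t))"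
          unfolding list_all2_conv_all_nth
        proof (intro conjI allI impI)
          fix i assume "i < length (row t)"
          then show "dist (row t ! i) (row (Suc t) ! i) \<le> \<theta>"
            using lenr nth Hd[of i i t "Suc t"] Suc.prems(1) by (simp add: less_Suc_eq_le)
        qed (simp add: lenr)
      qed (use ends Suc.prems(1) in auto)
      then show ?case using Suc.IH[OF _ k] Suc.prems(1) by (meson Suc_leD homotopic_paths_trans)
    qed
    moreover have "row m = W" by (rule nth_equalityI) (use lenr len nth Hm in auto)
    ultimately show ?thesis using h by auto
  qed
qed

lemma homotopic_paths_of_theta_homotopic:
  assumes short: "short_paths_homotopic X (2 * r)" and conn: "close_points_joined X \<theta> r"
    and r: "0 \<le> r" "0 \<le> \<theta>" and ZW: "theta_homotopic \<theta> X Z W"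
    and g: "tracks r X g Z" and h: "tracks r X h W"
  shows "homotopic_paths X g h"
proof -
  have "\<forall>h. tracks r X h W \<longrightarrow> homotopic_paths X g h"
    using ZW unfolding theta_homotopic_def
  proof (induction rule: equivclp_induct)
    case base
    then show ?case
      using g r by (auto intro!: homotopic_paths_of_close_tracks[OF short conn] simp: list_all2_conv_all_nth)
  next
    case (step Y V)
    \<comment> \<open>Every list occurring in a chain of steps is a discrete path, so the
      intermediate one can be traced and compared on both sides, whichever way the step
      points.\<close>
    have "theta_path \<theta> X Y" using step(2) by (auto simp: theta_step_def)
    then obtain k where k: "tracks r X k Y"
      using ex_tracks[OF conn r(1)] tracks_path_segment by metis
    have "homotopic_paths X k h" if h: "tracks r X h V" for h
      using step(2) homotopic_paths_of_theta_step[OF short conn r _ k h]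
        homotopic_paths_of_theta_step[OF short conn r _ h k] homotopic_paths_sym by blast
    then show ?case using step(3) k by (meson homotopic_paths_trans)
  qed
  then show ?thesis using h by blast
qed

section \<open>Scales supplied by the local conditions\<close>

lemma ex_close_points_joined:
  assumes "uniformly_locally_path_connected X" "0 < r"
  shows "\<exists>\<eta>>0. close_points_joined X \<eta> r"
proof -
  obtain \<delta> where \<delta>: "\<delta> > 0" "\<And>x y z. x \<in> X \<Longrightarrow> y \<in> X \<inter> ball x \<delta> \<Longrightarrow> z \<in> X \<inter> ball x \<delta> \<Longrightarrow>
      \<exists>g. path g \<and> path_image g \<subseteq> X \<inter> ball x r \<and> pathstart g = y \<and> pathfinish g = z"
    using assms unfolding uniformly_locally_path_connected_def by meson
  \<comment> \<open>Halving turns the weak inequality on distances into membership in the open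
    ball.\<close>
  have "close_points_joined X (\<delta> / 2) r"
    unfolding close_points_joined_def
  proof (intro ballI impI)
    fix x y assume xy: "x \<in> X" "y \<in> X" "dist x y \<le> \<delta> / 2"
    have "y \<in> X \<inter> ball x \<delta>" "x \<in> X \<inter> ball x \<delta>" using xy \<delta>(1) by auto
    then obtain g where g: "path g" "path_image g \<subseteq> X \<inter> ball x r" "pathstart g = x" "pathfinish g = y"
      using \<delta>(2)[OF xy(1), of x y] by blast
    moreover have "ball x r \<subseteq> cball x r" by (rule ball_subset_cball)
    ultimately show "\<exists>g. path g \<and> path_image g \<subseteq> X \<inter> cball x r \<and> pathstart g = x \<and> pathfinish g = y"
      by blast
  qed
  then show ?thesis using \<delta>(1) by (intro exI[of _ "\<delta> / 2"]) simp
qed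

lemma close_points_joined_mono: "close_points_joined X \<eta> r \<Longrightarrow> \<eta>' \<le> \<eta> \<Longrightarrow> close_points_joined X \<eta>' r"
  unfolding close_points_joined_def by (meson order_trans)

text \<open>For \<open>g\<close> and \<open>h\<close> with common ends the loop
  \<open>g +++ reversepath h\<close> is small, hence null-homotopic; inserting
  \<open>reversepath h +++ h\<close> after \<open>g\<close> and cancelling gives \<open>h\<close>.
  Half of \<open>\<epsilon>\<close> puts the closed ball inside the open one.\<close>

lemma ex_short_paths_homotopic:
  assumes "uniformly_semilocally_simply_connected X"
  shows "\<exists>r>0. short_paths_homotopic X r"
proof -
  obtain \<epsilon> where \<epsilon>: "\<epsilon> > 0" "\<forall>x\<in>X. \<forall>g. path g \<and> path_image g \<subseteq> X \<inter> ball x \<epsilon> \<and>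
      pathfinish g = pathstart g \<longrightarrow> homotopic_paths X g (\<lambda>_. pathstart g)"
    using assms unfolding uniformly_semilocally_simply_connected_def by (elim exE conjE) (rule that)
  have "homotopic_paths X g h"
    if x: "x \<in> X" and g: "path g" "path_image g \<subseteq> X \<inter> cball x (\<epsilon> / 2)"
      and h: "path h" "path_image h \<subseteq> X \<inter> cball x (\<epsilon> / 2)"
      and ends: "pathstart g = pathstart h" "pathfinish g = pathfinish h" for x g h
  proof -
    have X: "path_image g \<subseteq> X" "path_image h \<subseteq> X" using g h by auto
    have "cball x (\<epsilon> / 2) \<subseteq> ball x \<epsilon>" using \<epsilon>(1) by auto
    then have "path_image g \<subseteq> X \<inter> ball x \<epsilon>" "path_image (reversepath h) \<subseteq> X \<inter> ball x \<epsilon>"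
      using g(2) h(2) by auto
    then have "path_image (g +++ reversepath h) \<subseteq> X \<inter> ball x \<epsilon>" by (rule subset_path_image_join)
    then have "homotopic_paths X (g +++ reversepath h) (\<lambda>_. pathstart (g +++ reversepath h))"
      using g h ends by (intro \<epsilon>(2)[rule_format, OF x]) auto
    then have null: "homotopic_paths X (g +++ reversepath h) (\<lambda>_. pathstart h)" using ends by simp
    have "homotopic_paths X g (g +++ (\<lambda>_. pathfinish h))"
      using homotopic_paths_sym[OF homotopic_paths_const_right[OF g(1) X(1)]] ends by simp
    also have "homotopic_paths X (g +++ (\<lambda>_. pathfinish h)) (g +++ (reversepath h +++ h))"
      by (rule homotopic_paths_join[OF _ homotopic_paths_sym[OF homotopic_paths_reverse_left[OF h(1) X(2)]]])
        (use g X ends in \<open>auto simp: pathstart_def\<close>)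
    also have "homotopic_paths X (g +++ (reversepath h +++ h)) ((g +++ reversepath h) +++ h)"
      using g h X ends by (intro homotopic_paths_assoc) auto
    also have "homotopic_paths X ((g +++ reversepath h) +++ h) ((\<lambda>_. pathstart h) +++ h)"
      by (rule homotopic_paths_join[OF null]) (use h X in auto)
    also have "homotopic_paths X ((\<lambda>_. pathstart h) +++ h) h"
      using homotopic_paths_const_left[OF h(1) X(2)] .
    finally show ?thesis .
  qed
  then have "short_paths_homotopic X (\<epsilon> / 2)" unfolding short_paths_homotopic_def by blast
  then show ?thesis using \<epsilon>(1) by (intro exI[of _ "\<epsilon> / 2"]) simp
qed

section \<open>The homomorphism on classes and its bijectivity\<close>

text \<open>Well-definedness: by homotopy invariance, the union over all representatives and all
  their discretisations collapses to one class.\<close>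

lemma discretisation_hom_class:
  assumes "path p" "path_image p \<subseteq> X" "0 < \<theta>" "theta_discretisation \<theta> p Z"
  shows "discretisation_hom X (homotopy_class X p) \<theta> = theta_class \<theta> X Z"
proof -
  have eq: "theta_class \<theta> X W = theta_class \<theta> X Z"
    if "q \<in> homotopy_class X p" "theta_discretisation \<theta> q W" for q W
  proof -
    have "theta_homotopic \<theta> X Z W"
      using that assms by (intro theta_homotopic_of_homotopic_paths[of X p q]) (auto simp: homotopy_class_def)
    then show ?thesis unfolding theta_class_eq_iff by (rule theta_homotopic_sym)
  qed
  have "p \<in> homotopy_class X p" using assms by (simp add: homotopy_class_def)
  then have "(\<Union>q\<in>homotopy_class X p. \<Union>W\<in>{W. theta_discretisation \<theta> q W}. theta_class \<theta> X W) =
      theta_class \<theta> X Z"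
    using eq assms(4) by blast
  then show ?thesis using assms(3) by (simp add: discretisation_hom_def)
qed

lemma theta_discretisation_loop:
  assumes "p \<in> loops_at X x0" "0 < \<theta>" "theta_discretisation \<theta> p Z"
  shows "Z \<in> theta_loops_at \<theta> X x0"
  using assms theta_discretisation_theta_path[of p X \<theta> Z] by (auto simp: loops_at_def theta_loops_at_def)

lemma carrier_discrete_limit_group:
  "c \<in> carrier (discrete_limit_group X x0) \<longleftrightarrow>
    c \<in> extensional {0<..} \<and> (\<forall>\<theta>>0. \<exists>Z\<in>theta_loops_at \<theta> X x0. c \<theta> = theta_class \<theta> X Z) \<and>
    (\<forall>\<theta>' \<theta>. 0 < \<theta>' \<and> \<theta>' \<le> \<theta> \<longrightarrow> scale_map X \<theta> (c \<theta>') = c \<theta>)"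
  by (auto simp: discrete_limit_group_def Let_def discrete_fundamental_group_def PiE_iff image_iff)

lemma mult_discrete_limit_group:
  "b \<otimes>\<^bsub>discrete_limit_group X x0\<^esub> c =
    (\<lambda>\<theta>\<in>{0<..}. b \<theta> \<otimes>\<^bsub>discrete_fundamental_group X x0 \<theta>\<^esub> c \<theta>)"
  by (simp add: discrete_limit_group_def Let_def)

lemma discretisation_hom_hom:
  "discretisation_hom X \<in> hom (fundamental_group X x0) (discrete_limit_group X x0)"
proof (rule homI)
  fix A assume "A \<in> carrier (fundamental_group X x0)"
  then obtain p where p: "p \<in> loops_at X x0" "A = homotopy_class X p"
    by (auto simp: fundamental_group_def)
  then have pp: "path p" "path_image p \<subseteq> X" by (auto simp: loops_at_def)
  show "discretisation_hom X A \<in> carrier (discrete_limit_group X x0)"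
    unfolding carrier_discrete_limit_group
  proof (intro conjI allI impI)
    show "discretisation_hom X A \<in> extensional {0<..}" by (simp add: discretisation_hom_def)
  next
    fix \<theta> :: real assume "0 < \<theta>"
    then obtain Z where "theta_discretisation \<theta> p Z" using ex_theta_discretisation[OF pp(1)] by blast
    then show "\<exists>Z\<in>theta_loops_at \<theta> X x0. discretisation_hom X A \<theta> = theta_class \<theta> X Z"
      using discretisation_hom_class[OF pp \<open>0 < \<theta>\<close>] theta_discretisation_loop[OF p(1) \<open>0 < \<theta>\<close>] p(2) by blast
  next
    fix \<theta>' \<theta> :: real assume t: "0 < \<theta>' \<and> \<theta>' \<le> \<theta>"
    then obtain Z where Z: "theta_discretisation \<theta>' p Z" using ex_theta_discretisation[OF pp(1)] by blast
    \<comment> \<open>The same list is a discretisation at both scales, so the family is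
      compatible.\<close>
    then have "theta_discretisation \<theta> p Z" using t theta_discretisation_mono by blast
    then show "scale_map X \<theta> (discretisation_hom X A \<theta>') = discretisation_hom X A \<theta>"
      using t discretisation_hom_class[OF pp _ Z] discretisation_hom_class[OF pp, of \<theta> Z]
        scale_map_class[of \<theta>' \<theta> X Z] p(2) by simp
  qed
next
  fix A B assume "A \<in> carrier (fundamental_group X x0)" "B \<in> carrier (fundamental_group X x0)"
  then obtain p q where p: "p \<in> loops_at X x0" "A = homotopy_class X p"
    and q: "q \<in> loops_at X x0" "B = homotopy_class X q"
    by (auto simp: fundamental_group_def)
  then have pp: "path p" "path_image p \<subseteq> X" and qq: "path q" "path_image q \<subseteq> X"
    by (auto simp: loops_at_def)
  have pq: "p +++ q \<in> loops_at X x0" using loops_at_join p(1) q(1) .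
  then have ppq: "path (p +++ q)" "path_image (p +++ q) \<subseteq> X" by (auto simp: loops_at_def)
  have "discretisation_hom X (homotopy_class X (p +++ q)) \<theta> =
      discretisation_hom X A \<theta> \<otimes>\<^bsub>discrete_fundamental_group X x0 \<theta>\<^esub> discretisation_hom X B \<theta>"
    if t: "0 < \<theta>" for \<theta>
  proof -
    obtain Z W where Z: "theta_discretisation \<theta> p Z" and W: "theta_discretisation \<theta> q W"
      using ex_theta_discretisation[OF pp(1) t] ex_theta_discretisation[OF qq(1) t] by blast
    then have "theta_discretisation \<theta> (p +++ q) (Z @ tl W)"
      using pp qq p(1) q(1) t by (intro theta_discretisation_join) (auto simp: loops_at_def)
    then show ?thesis
      using discretisation_hom_class[OF ppq t] discretisation_hom_class[OF pp t Z]
        discretisation_hom_class[OF qq t W] p(2) q(2)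
        discrete_fundamental_group_mult[OF theta_discretisation_loop[OF p(1) t Z]
          theta_discretisation_loop[OF q(1) t W] t] by simp
  qed
  then show "discretisation_hom X (A \<otimes>\<^bsub>fundamental_group X x0\<^esub> B) =
      discretisation_hom X A \<otimes>\<^bsub>discrete_limit_group X x0\<^esub> discretisation_hom X B"
    unfolding mult_discrete_limit_group p(2) q(2) fundamental_group_mult[OF p(1) q(1)]
    by (intro extensionalityI[of _ "{0<..}"]) (auto simp: discretisation_hom_def)
qed

lemma inj_on_discretisation_hom:
  assumes short: "short_paths_homotopic X (2 * r)" and conn: "close_points_joined X \<eta> r"
    and "0 < r" "0 < \<eta>"
  shows "inj_on (discretisation_hom X) (carrier (fundamental_group X x0))"
proof (rule inj_onI)
  fix A B assume "A \<in> carrier (fundamental_group X x0)" "B \<in> carrier (fundamental_group X x0)"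
    and eq: "discretisation_hom X A = discretisation_hom X B"
  then obtain p q where p: "p \<in> loops_at X x0" "A = homotopy_class X p"
    and q: "q \<in> loops_at X x0" "B = homotopy_class X q"
    by (auto simp: fundamental_group_def)
  then have pp: "path p" "path_image p \<subseteq> X" and qq: "path q" "path_image q \<subseteq> X"
    by (auto simp: loops_at_def)
  \<comment> \<open>Below \<open>r\<close>, so that a discretisation is a tracked list; below
    \<open>\<eta>\<close>, so that points at this distance are joined within
    \<open>r\<close>.\<close>
  define \<theta> where "\<theta> = min r \<eta>"
  have t: "0 < \<theta>" "\<theta> \<le> r" "\<theta> \<le> \<eta>" using assms by (auto simp: \<theta>_def)
  obtain Z W where Z: "theta_discretisation \<theta> p Z" and W: "theta_discretisation \<theta> q W"
    using ex_theta_discretisation[OF pp(1) t(1)] ex_theta_discretisation[OF qq(1) t(1)] by blast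
  have "theta_homotopic \<theta> X Z W"
    using eq discretisation_hom_class[OF pp t(1) Z] discretisation_hom_class[OF qq t(1) W] p(2) q(2)
    by (simp flip: theta_class_eq_iff)
  moreover have "tracks r X p Z" "tracks r X q W"
    using tracks_of_discretisation[OF pp theta_discretisation_mono[OF Z t(2)]]
      tracks_of_discretisation[OF qq theta_discretisation_mono[OF W t(2)]] assms by auto
  ultimately have "homotopic_paths X p q"
    using homotopic_paths_of_theta_homotopic[OF short close_points_joined_mono[OF conn t(3)]] t by auto
  then show "A = B" using homotopy_class_eq_iff[OF pp] p(2) q(2) by simp
qed

text \<open>Repeating the first point gives every discrete loop at least two entries, so that the
  constant one-point loop can be realised too. The index map is truncated subtraction, which sends
  both 0 and 1 to 0.\<close>

lemma theta_homotopic_Cons_hd: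
  assumes "theta_path \<theta> X Z" "0 \<le> \<theta>"
  shows "theta_homotopic \<theta> X Z (hd Z # Z)"
proof -
  obtain x V where Z: "Z = x # V" using assms(1) by (cases Z) (auto simp: theta_path_def)
  have "(\<lambda>i. i - 1) ` {..<Suc (length Z)} = {..<length Z}"
  proof (intro equalityI subsetI)
    fix i assume "i \<in> {..<length Z}"
    then show "i \<in> (\<lambda>i. i - 1) ` {..<Suc (length Z)}" by (intro image_eqI[of _ _ "Suc i"]) auto
  qed (auto simp: Z)
  then have "lazification Z (hd Z # Z)"
    unfolding lazification_def
    by (intro conjI exI[of _ "\<lambda>i. i - 1"]) (auto simp: Z mono_on_def nth_Cons split: nat.splits)
  moreover have "theta_path \<theta> X (hd Z # Z)"
    using assms unfolding theta_path_def
    by (auto simp: nth_Cons hd_conv_nth split: nat.splits)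
  ultimately show ?thesis using assms(1) by (intro theta_homotopic_step) (auto simp: theta_step_def)
qed

lemma ex_loop_realisation:
  assumes conn: "close_points_joined X \<theta> \<epsilon>" and "0 \<le> \<epsilon>" "0 < \<theta>" and Z: "Z \<in> theta_loops_at \<theta> X x0"
  shows "\<exists>p\<in>loops_at X x0. \<exists>W. theta_discretisation \<epsilon> p W \<and> theta_class \<theta> X Z = theta_class \<theta> X W"
proof -
  let ?W = "hd Z # Z"
  note Zp = theta_loops_atD[OF Z]
  have ZW: "theta_homotopic \<theta> X Z ?W" using Zp assms(3) by (intro theta_homotopic_Cons_hd) auto
  then have W: "theta_path \<theta> X ?W" using theta_homotopic_theta_path Zp(1) by blast
  have "2 \<le> length ?W" using Zp(2) by (cases Z) auto
  then obtain p where p: "path p" "path_image p \<subseteq> X" "theta_discretisation \<epsilon> p ?W"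
    using ex_realisation[OF conn assms(2) W] by blast
  then have "p \<in> loops_at X x0"
    using theta_discretisation_theta_path[OF p(1,2) assms(2) p(3)] Zp by (auto simp: loops_at_def)
  then show ?thesis using p(3) ZW theta_class_eq_iff by blast
qed

lemma discretisation_hom_surj:
  assumes X: "uniformly_locally_path_connected X"
    and short: "short_paths_homotopic X (2 * r)" and conn: "close_points_joined X \<eta> r"
    and "0 < r" "0 < \<eta>" and c: "c \<in> carrier (discrete_limit_group X x0)"
  shows "c \<in> discretisation_hom X ` carrier (fundamental_group X x0)"
proof -
  note c_ext = c[unfolded carrier_discrete_limit_group, THEN conjunct1]
    and c_class = c[unfolded carrier_discrete_limit_group, THEN conjunct2, THEN conjunct1, rule_format]
    and c_scale = c[unfolded carrier_discrete_limit_group, THEN conjunct2, THEN conjunct2, rule_format]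
  obtain p Z where p: "p \<in> loops_at X x0" and Z: "theta_discretisation r p Z" "c \<eta> = theta_class \<eta> X Z"
    using c_class[OF \<open>0 < \<eta>\<close>] ex_loop_realisation[OF conn _ \<open>0 < \<eta>\<close>] \<open>0 < r\<close> by (metis less_imp_le)
  have pp: "path p" "path_image p \<subseteq> X" using p by (auto simp: loops_at_def)
  have "discretisation_hom X (homotopy_class X p) \<theta> = c \<theta>" if "0 < \<theta>" for \<theta>
  proof -
    \<comment> \<open>At most \<open>r\<close>, so that \<open>q\<close> can be compared with
      \<open>p\<close> by tracking at radius \<open>r\<close>; at most \<open>\<theta>\<close>, so
      that \<open>W\<close> is a discretisation of \<open>q\<close> at the scale in
      question.\<close>
    define \<epsilon> where "\<epsilon> = min r \<theta>"
    have \<epsilon>: "0 < \<epsilon>" "\<epsilon> \<le> r" "\<epsilon> \<le> \<theta>" using \<open>0 < r\<close> \<open>0 < \<theta>\<close> by (auto simp: \<epsilon>_def)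
    obtain \<delta> where \<delta>: "0 < \<delta>" "close_points_joined X \<delta> \<epsilon>"
      using ex_close_points_joined[OF X \<epsilon>(1)] by blast
    \<comment> \<open>At most \<open>\<delta>\<close>, so that a representative can be traced in
      balls of radius \<open>\<epsilon>\<close>; at most \<open>\<eta>\<close> and
      \<open>\<theta>\<close>, so that \<open>c \<theta>'\<close> determines the family at both
      scales.\<close>
    define \<theta>' where "\<theta>' = min \<delta> (min \<eta> \<theta>)"
    have \<theta>': "0 < \<theta>'" "\<theta>' \<le> \<delta>" "\<theta>' \<le> \<eta>" "\<theta>' \<le> \<theta>"
      using \<delta> \<open>0 < \<eta>\<close> \<open>0 < \<theta>\<close> by (auto simp: \<theta>'_def)
    obtain q W where q: "q \<in> loops_at X x0" and W: "theta_discretisation \<epsilon> q W" "c \<theta>' = theta_class \<theta>' X W"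
      using c_class[OF \<theta>'(1)] ex_loop_realisation[OF close_points_joined_mono[OF \<delta>(2) \<theta>'(2)] _ \<theta>'(1)] \<epsilon>(1)
      by (metis less_imp_le)
    have qq: "path q" "path_image q \<subseteq> X" using q by (auto simp: loops_at_def)
    have "theta_class \<eta> X Z = theta_class \<eta> X W"
      using c_scale[of \<theta>' \<eta>] \<theta>' W(2) Z(2) scale_map_class by metis
    then have "theta_homotopic \<eta> X Z W" by (simp add: theta_class_eq_iff)
    moreover have "tracks r X p Z" "tracks r X q W"
      using tracks_of_discretisation[OF pp Z(1)]
        tracks_of_discretisation[OF qq theta_discretisation_mono[OF W(1) \<epsilon>(2)]] \<open>0 < r\<close> by auto
    ultimately have "homotopic_paths X p q"
      using homotopic_paths_of_theta_homotopic[OF short conn] \<open>0 < r\<close> \<open>0 < \<eta>\<close> by auto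
    then have "homotopy_class X p = homotopy_class X q" using homotopy_class_eq_iff[OF pp] by simp
    then have "discretisation_hom X (homotopy_class X p) \<theta> = theta_class \<theta> X W"
      using discretisation_hom_class[OF qq \<open>0 < \<theta>\<close> theta_discretisation_mono[OF W(1) \<epsilon>(3)]] by simp
    also have "\<dots> = c \<theta>"
      using c_scale[of \<theta>' \<theta>] \<theta>' W(2) scale_map_class by metis
    finally show ?thesis .
  qed
  then have "c = discretisation_hom X (homotopy_class X p)"
    using c_ext by (intro extensionalityI[of _ "{0<..}"]) (auto simp: discretisation_hom_def)
  then show ?thesis using p by (auto simp: fundamental_group_def)
qed

theorem theorem3p2:
  fixes X :: "'a::metric_space set" and x0 :: 'a
  assumes "uniformly_locally_path_connected X"
    and "uniformly_semilocally_simply_connected X"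
    and "x0 \<in> X"
  shows "discretisation_hom X \<in> iso (fundamental_group X x0) (discrete_limit_group X x0)"
proof -
  obtain R where R: "0 < R" "short_paths_homotopic X R"
    using ex_short_paths_homotopic[OF assms(2)] by blast
  \<comment> \<open>The squares of a ladder with pieces of radius \<open>r\<close> fill balls of
    radius \<open>2 * r\<close>.\<close>
  define r where "r = R / 2"
  have r: "0 < r" "short_paths_homotopic X (2 * r)" using R by (simp_all add: r_def)
  obtain \<eta> where \<eta>: "0 < \<eta>" "close_points_joined X \<eta> r"
    using ex_close_points_joined[OF assms(1) r(1)] by blast
  have "discretisation_hom X ` carrier (fundamental_group X x0) = carrier (discrete_limit_group X x0)"
    using hom_carrier[OF discretisation_hom_hom] discretisation_hom_surj[OF assms(1) r(2) \<eta>(2) r(1) \<eta>(1)]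
    by blast
  then show ?thesis
    unfolding iso_def bij_betw_def
    using discretisation_hom_hom inj_on_discretisation_hom[OF r(2) \<eta>(2) r(1) \<eta>(1)] by blast
qed

end
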